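(* Let $\mathrm N_{n,r}$ be the free $r$-step nilpotent group of rank $n\ge 2$ with basis $X=\{x_1,\ldots,x_n\}$. Then: (1) For $n>1$ and $r\ge 3$, $\ 2(n-1)\le \mathrm{pw}(\mathrm N_{n,r},X)\le 3n$. (2) $\ 2(n-1)\le \mathrm{pw}(\mathrm N_{n,2},X)\le 3(n-1)$.
   Context: Let $G$ be a group with generating set $S$. A (freely) reduced word in the alphabet $S^{\pm1}$ is a palindrome if it reads the same left-to-right and right-to-left; an element of $G$ is a palindrome (with respect to $S$) if it is represented by some palindromic word in $S^{\pm1}$. The palindromic length $l_{\mathcal P}(g)$ of $g\in G$ is the minimal $k$ such that $g$ is a product of $k$ palindromes, and the palindromic width is $\mathrm{pw}(G,S)=\sup_{g\in G} l_{\mathcal P}(g)$. The free $r$-step nilpotent group of rank $n$ is $\mathrm N_{n,r}=F_n/\gamma_{r+1}(F_n)$, where $F_n$ is the free group of rank $n$ and $\gamma_k$ denotes the $k$-th term of the lower central series ($\gamma_1(F_n)=F_n$); its basis $X$ is the image of a free basis of $F_n$. *)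

theory Defs
  imports "HOL-Algebra.Algebra" "HOL-Library.Extended_Nat"
begin

section \<open>Words in an alphabet of the form \<open>S\<^sup>\<plusminus>\<close>\<close>

text \<open>The letter \<open>(s, True)\<close> stands for \<open>s\<close>, the letter \<open>(s, False)\<close> for its formal inverse.\<close>

type_synonym 'a letter = "'a \<times> bool"

definition inv_letter :: "'a letter \<Rightarrow> 'a letter" where
  "inv_letter = apsnd Not"

definition freely_reduced :: "'a letter list \<Rightarrow> bool" where
  "freely_reduced = successively (\<lambda>a b. b \<noteq> inv_letter a)"

fun cancel_Cons :: "'a letter \<Rightarrow> 'a letter list \<Rightarrow> 'a letter list" where
  "cancel_Cons a [] = [a]"
| "cancel_Cons a (b # w) = (if b = inv_letter a then w else a # b # w)"

text \<open>For reduced words \<open>u\<close> and \<open>v\<close>, \<open>foldr cancel_Cons u v\<close> is the reduced form of \<open>u @ v\<close>.\<close>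

definition free_group :: "'a set \<Rightarrow> 'a letter list monoid" where
  "free_group A =
     \<lparr>carrier = {w. set w \<subseteq> A \<times> UNIV \<and> freely_reduced w},
      monoid.mult = (\<lambda>u v. foldr cancel_Cons u v),
      one = []\<rparr>"

fun letter_value :: "('a, 'm) monoid_scheme \<Rightarrow> 'a letter \<Rightarrow> 'a" where
  "letter_value G (x, b) = (if b then x else inv\<^bsub>G\<^esub> x)"

definition list_mult :: "('a, 'm) monoid_scheme \<Rightarrow> 'a list \<Rightarrow> 'a" where
  "list_mult G xs = foldr (\<otimes>\<^bsub>G\<^esub>) xs \<one>\<^bsub>G\<^esub>"

definition word_value :: "('a, 'm) monoid_scheme \<Rightarrow> 'a letter list \<Rightarrow> 'a" where
  "word_value G w = list_mult G (map (letter_value G) w)"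


section \<open>Palindromic width\<close>

definition palindromic_word :: "'a letter list \<Rightarrow> bool" where
  "palindromic_word w \<longleftrightarrow> freely_reduced w \<and> rev w = w"

definition palindromes :: "('a, 'm) monoid_scheme \<Rightarrow> 'a set \<Rightarrow> 'a set" where
  "palindromes G S = {word_value G w | w. set w \<subseteq> S \<times> UNIV \<and> palindromic_word w}"

text \<open>Both quantities are \<open>\<infinity>\<close> when no finite bound exists.  An infimum of a nonempty
  set of type \<^typ>\<open>enat\<close> is a minimum.\<close>

definition palindromic_length :: "('a, 'm) monoid_scheme \<Rightarrow> 'a set \<Rightarrow> 'a \<Rightarrow> enat" where
  "palindromic_length G S g =
     Inf {enat (length ps) | ps. set ps \<subseteq> palindromes G S \<and> list_mult G ps = g}"

definition palindromic_width :: "('a, 'm) monoid_scheme \<Rightarrow> 'a set \<Rightarrow> enat" where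
  "palindromic_width G S = (SUP g\<in>carrier G. palindromic_length G S g)"


section \<open>Free nilpotent groups\<close>

text \<open>The usual numbering, starting with \<open>\<gamma>\<^sub>1(G) = G\<close>; the value at \<open>0\<close> is a dummy.\<close>

fun lower_central :: "('a, 'm) monoid_scheme \<Rightarrow> nat \<Rightarrow> 'a set" where
  "lower_central G 0 = carrier G"
| "lower_central G (Suc 0) = carrier G"
| "lower_central G (Suc (Suc k)) =
     generate G {x \<otimes>\<^bsub>G\<^esub> y \<otimes>\<^bsub>G\<^esub> inv\<^bsub>G\<^esub> x \<otimes>\<^bsub>G\<^esub> inv\<^bsub>G\<^esub> y |
       x y. x \<in> lower_central G (Suc k) \<and> y \<in> carrier G}"

definition free_nilpotent :: "nat \<Rightarrow> nat \<Rightarrow> nat letter list set monoid" where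
  "free_nilpotent n r = free_group {1..n} Mod lower_central (free_group {1..n}) (r + 1)"

definition free_nilpotent_basis :: "nat \<Rightarrow> nat \<Rightarrow> nat letter list set set" where
  "free_nilpotent_basis n r =
     (\<lambda>i. lower_central (free_group {1..n}) (r + 1) #>\<^bsub>free_group {1..n}\<^esub> [(i, True)]) ` {1..n}"


section \<open>Basic facts\<close>

lemma inv_letter_inv_letter [simp]: "inv_letter (inv_letter a) = a"
  by (cases a) (simp add: inv_letter_def)

lemma fst_inv_letter [simp]: "fst (inv_letter a) = fst a"
  by (simp add: inv_letter_def)

lemma freely_reduced_Nil [simp]: "freely_reduced []"
  by (simp add: freely_reduced_def)

lemma freely_reduced_Cons:
  "freely_reduced (a # w) \<longleftrightarrow> freely_reduced w \<and> (w = [] \<or> hd w \<noteq> inv_letter a)"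
  by (auto simp: freely_reduced_def successively_Cons)

lemma freely_reduced_cancel_Cons: "freely_reduced w \<Longrightarrow> freely_reduced (cancel_Cons a w)"
  by (cases w) (auto simp: freely_reduced_Cons)

lemma freely_reduced_foldr: "freely_reduced v \<Longrightarrow> freely_reduced (foldr cancel_Cons u v)"
  by (induction u) (auto simp: freely_reduced_cancel_Cons)

lemma set_cancel_Cons: "set (cancel_Cons a w) \<subseteq> insert a (set w)"
  by (cases w) auto

lemma set_foldr_cancel_Cons: "set (foldr cancel_Cons u v) \<subseteq> set u \<union> set v"
proof (induction u)
  case (Cons a u)
  then show ?case using set_cancel_Cons[of a "foldr cancel_Cons u v"] by auto
qed simp

lemma cancel_Cons_inv_letter:
  "freely_reduced w \<Longrightarrow> cancel_Cons a (cancel_Cons (inv_letter a) w) = w"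
  by (cases w rule: remdups_adj.cases) (auto simp: freely_reduced_Cons)

lemma foldr_cancel_Cons_assoc1:
  assumes "freely_reduced w"
  shows "foldr cancel_Cons (cancel_Cons a v) w = cancel_Cons a (foldr cancel_Cons v w)"
  using assms by (cases v) (auto simp: cancel_Cons_inv_letter freely_reduced_foldr)

lemma foldr_cancel_Cons_assoc:
  assumes "freely_reduced w"
  shows "foldr cancel_Cons (foldr cancel_Cons u v) w = foldr cancel_Cons u (foldr cancel_Cons v w)"
  using assms by (induction u) (auto simp: foldr_cancel_Cons_assoc1)

lemma foldr_cancel_Cons_Nil: "freely_reduced w \<Longrightarrow> foldr cancel_Cons w [] = w"
proof (induction w)
  case (Cons a w)
  then show ?case by (cases w) (auto simp: freely_reduced_Cons)
qed simp

lemma foldr_cancel_Cons_inverse: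
  "freely_reduced w \<Longrightarrow> foldr cancel_Cons (rev (map inv_letter u)) (foldr cancel_Cons u w) = w"
proof (induction u arbitrary: w)
  case (Cons a u)
  then show ?case
    using cancel_Cons_inv_letter[of "foldr cancel_Cons u w" "inv_letter a"]
    by (simp add: freely_reduced_foldr)
qed simp

lemma freely_reduced_inverse: "freely_reduced w \<Longrightarrow> freely_reduced (rev (map inv_letter w))"
  unfolding freely_reduced_def successively_rev successively_map
  by (erule successively_mono) (metis inv_letter_inv_letter)

lemma group_free_group: "group (free_group A)"
proof (rule groupI)
  fix x assume x: "x \<in> carrier (free_group A)"
  have "set (rev (map inv_letter x)) \<subseteq> A \<times> UNIV"
    using x by (auto simp: free_group_def inv_letter_def)
  then have "rev (map inv_letter x) \<in> carrier (free_group A)"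
    using x by (simp add: free_group_def freely_reduced_inverse)
  moreover have "foldr cancel_Cons (rev (map inv_letter x)) x = []"
    using x foldr_cancel_Cons_inverse[of "[]" x] by (simp add: free_group_def foldr_cancel_Cons_Nil)
  ultimately show "\<exists>y\<in>carrier (free_group A). y \<otimes>\<^bsub>free_group A\<^esub> x = \<one>\<^bsub>free_group A\<^esub>"
    by (intro bexI[of _ "rev (map inv_letter x)"]) (simp_all add: free_group_def)
next
  fix x y assume "x \<in> carrier (free_group A)" "y \<in> carrier (free_group A)"
  then show "x \<otimes>\<^bsub>free_group A\<^esub> y \<in> carrier (free_group A)"
    using set_foldr_cancel_Cons[of x y] by (auto simp: free_group_def freely_reduced_foldr)
qed (auto simp: free_group_def foldr_cancel_Cons_assoc)

lemma (in group) letter_value_closed: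
  "fst a \<in> carrier G \<Longrightarrow> letter_value G a \<in> carrier G"
  by (cases a) auto

lemma (in group) word_value_Cons:
  "word_value G (a # w) = letter_value G a \<otimes> word_value G w"
  by (simp add: word_value_def list_mult_def)

lemma (in group) word_value_closed:
  "fst ` set w \<subseteq> carrier G \<Longrightarrow> word_value G w \<in> carrier G"
proof (induction w)
  case Nil
  then show ?case by (simp add: word_value_def list_mult_def)
next
  case (Cons a w)
  then show ?case by (simp add: word_value_Cons letter_value_closed)
qed

lemma (in group) word_value_cancel_Cons:
  assumes "fst a \<in> carrier G" "fst ` set w \<subseteq> carrier G"
  shows "word_value G (cancel_Cons a w) = letter_value G a \<otimes> word_value G w"
proof (cases w)
  case Nil
  then show ?thesis by (simp add: word_value_Cons)
next
  case (Cons b v)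
  have "letter_value G a \<otimes> (letter_value G (inv_letter a) \<otimes> word_value G v) = word_value G v"
    using assms Cons word_value_closed[of v]
    by (cases a) (auto simp: inv_letter_def m_assoc[symmetric])
  then show ?thesis using Cons by (simp add: word_value_Cons)
qed

lemma (in group) word_value_foldr:
  assumes "fst ` set u \<subseteq> carrier G" "fst ` set v \<subseteq> carrier G"
  shows "word_value G (foldr cancel_Cons u v) = word_value G u \<otimes> word_value G v"
  using assms
proof (induction u)
  case Nil
  then show ?case using word_value_closed[of v] by (simp add: word_value_def list_mult_def)
next
  case (Cons a u)
  have "fst ` set (foldr cancel_Cons u v) \<subseteq> carrier G"
    using Cons.prems set_foldr_cancel_Cons[of u v] by fastforce
  then show ?case
    using Cons
    by (simp add: word_value_cancel_Cons word_value_Cons m_assoc word_value_closed letter_value_closed)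
qed

lemma (in group) word_value_map_closed:
  assumes "f ` A \<subseteq> carrier G" "set w \<subseteq> A \<times> UNIV"
  shows "word_value G (map (apfst f) w) \<in> carrier G"
proof (rule word_value_closed, rule subsetI)
  fix x assume "x \<in> fst ` set (map (apfst f) w)"
  then obtain a where "a \<in> set w" "x = f (fst a)" by auto
  then show "x \<in> carrier G" using assms by (metis SigmaD1 image_subset_iff prod.collapse subset_iff)
qed

text \<open>The universal property of the free group.\<close>

lemma map_apfst_cancel_Cons:
  assumes "group G" "f ` fst ` set (a # w) \<subseteq> carrier G"
  shows "word_value G (map (apfst f) (cancel_Cons a w)) =
         letter_value G (apfst f a) \<otimes>\<^bsub>G\<^esub> word_value G (map (apfst f) w)"
proof (cases w)
  case Nil
  then show ?thesis using assms by (simp add: group.word_value_Cons)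
next
  case (Cons b v)
  interpret group G by fact
  show ?thesis
  proof (cases "b = inv_letter a")
    case True
    have 1: "apfst f (inv_letter a) = inv_letter (apfst f a)"
      by (cases a) (simp add: inv_letter_def)
    have "word_value G (cancel_Cons (apfst f a) (inv_letter (apfst f a) # map (apfst f) v)) =
      letter_value G (apfst f a) \<otimes>\<^bsub>G\<^esub> word_value G (inv_letter (apfst f a) # map (apfst f) v)"
      using assms Cons True by (intro word_value_cancel_Cons) (auto simp: image_image)
    then show ?thesis using Cons True 1 by simp
  next
    case False
    then show ?thesis using Cons by (simp add: word_value_Cons)
  qed
qed

lemma free_group_hom:
  assumes "group G" "f ` A \<subseteq> carrier G"
  shows "(\<lambda>w. word_value G (map (apfst f) w)) \<in> hom (free_group A) G"
proof (rule homI)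
  interpret group G by fact
  fix u assume u: "u \<in> carrier (free_group A)"
  then show "word_value G (map (apfst f) u) \<in> carrier G"
    using assms by (intro word_value_map_closed) (auto simp: free_group_def)
  fix v assume v: "v \<in> carrier (free_group A)"
  have "word_value G (map (apfst f) (foldr cancel_Cons u v)) =
        word_value G (map (apfst f) u) \<otimes>\<^bsub>G\<^esub> word_value G (map (apfst f) v)"
    if "set u \<subseteq> A \<times> UNIV" for u
    using that
  proof (induction u)
    case Nil
    have "word_value G (map (apfst f) v) \<in> carrier G"
      using assms v by (intro word_value_map_closed) (auto simp: free_group_def)
    then show ?case by (simp add: word_value_def list_mult_def)
  next
    case (Cons a u)
    have "set (foldr cancel_Cons u v) \<subseteq> A \<times> UNIV"
      using Cons.prems v set_foldr_cancel_Cons[of u v] by (auto simp: free_group_def)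
    then have "word_value G (map (apfst f) (cancel_Cons a (foldr cancel_Cons u v))) =
      letter_value G (apfst f a) \<otimes>\<^bsub>G\<^esub> word_value G (map (apfst f) (foldr cancel_Cons u v))"
      using Cons.prems assms by (cases a, intro map_apfst_cancel_Cons) (auto simp: image_subset_iff subset_iff)
    moreover have "letter_value G (apfst f a) \<in> carrier G"
      using Cons.prems assms by (intro letter_value_closed) (auto simp: image_subset_iff)
    moreover have "word_value G (map (apfst f) u) \<in> carrier G"
      using assms Cons.prems by (intro word_value_map_closed) auto
    moreover have "word_value G (map (apfst f) v) \<in> carrier G"
      using assms v by (intro word_value_map_closed) (auto simp: free_group_def)
    ultimately show ?case
      using Cons by (simp add: word_value_Cons m_assoc)
  qed
  then show "word_value G (map (apfst f) (u \<otimes>\<^bsub>free_group A\<^esub> v)) =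
        word_value G (map (apfst f) u) \<otimes>\<^bsub>G\<^esub> word_value G (map (apfst f) v)"
    using u by (simp add: free_group_def)
qed

lemma (in group) lower_central_normal: "lower_central G k \<lhd> G"
proof (induction k rule: induct_nat_012)
  case (ge2 k)
  define S where "S = {x \<otimes> y \<otimes> inv x \<otimes> inv y | x y. x \<in> lower_central G (Suc k) \<and> y \<in> carrier G}"
  interpret N: normal "lower_central G (Suc k)" G by (rule ge2)
  have "generate G S \<lhd> G"
  proof (rule normal_generateI)
    show "S \<subseteq> carrier G" by (auto simp: S_def N.mem_carrier)
  next
    fix h g assume h: "h \<in> S" and g: "g \<in> carrier G"
    from h obtain x y where xy: "h = x \<otimes> y \<otimes> inv x \<otimes> inv y"
      "x \<in> lower_central G (Suc k)" "y \<in> carrier G" by (auto simp: S_def)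
    have x: "x \<in> carrier G" using xy by (simp add: N.mem_carrier)
    have cancel: "inv g \<otimes> (g \<otimes> z) = z" if "z \<in> carrier G" for z
      using g that by (simp add: m_assoc[symmetric])
    have "g \<otimes> h \<otimes> inv g = (g \<otimes> x \<otimes> inv g) \<otimes> (g \<otimes> y \<otimes> inv g) \<otimes>
        inv (g \<otimes> x \<otimes> inv g) \<otimes> inv (g \<otimes> y \<otimes> inv g)"
      using x xy g by (simp add: inv_mult_group m_assoc cancel)
    moreover have "g \<otimes> x \<otimes> inv g \<in> lower_central G (Suc k)"
      using N.inv_op_closed2 g xy by blast
    moreover have "g \<otimes> y \<otimes> inv g \<in> carrier G" using xy g by simp
    ultimately show "g \<otimes> h \<otimes> inv g \<in> S" unfolding S_def by blast
  qed
  then show ?case by (simp add: S_def)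
qed (simp_all add: normal_self)

lemma group_free_nilpotent: "group (free_nilpotent n r)"
  unfolding free_nilpotent_def
  by (intro normal.factorgroup_is_group group.lower_central_normal group_free_group)

lemma generate_free_group:
  "generate (free_group A) ((\<lambda>x. [(x, True)]) ` A) = carrier (free_group A)"
proof
  interpret group "free_group A" by (rule group_free_group)
  have gens: "(\<lambda>x. [(x, True)]) ` A \<subseteq> carrier (free_group A)"
    by (auto simp: free_group_def freely_reduced_Cons)
  then show "generate (free_group A) ((\<lambda>x. [(x, True)]) ` A) \<subseteq> carrier (free_group A)"
    by (rule generate_incl)
  have letter: "[(x, b)] \<in> generate (free_group A) ((\<lambda>x. [(x, True)]) ` A)" if "x \<in> A" for x b
  proof (cases b)
    case True
    then show ?thesis using that by (simp add: generate.incl)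
  next
    case False
    have "inv\<^bsub>free_group A\<^esub> [(x, True)] = [(x, False)]"
      using that
      by (intro inv_equality) (auto simp: free_group_def freely_reduced_Cons inv_letter_def)
    moreover have "[(x, True)] \<in> (\<lambda>x. [(x, True)]) ` A" using that by (rule imageI)
    then have "inv\<^bsub>free_group A\<^esub> [(x, True)] \<in> generate (free_group A) ((\<lambda>x. [(x, True)]) ` A)"
      by (rule generate.inv)
    ultimately show ?thesis using False by simp
  qed
  show "carrier (free_group A) \<subseteq> generate (free_group A) ((\<lambda>x. [(x, True)]) ` A)"
  proof
    fix w assume "w \<in> carrier (free_group A)"
    then have "set w \<subseteq> A \<times> UNIV" "freely_reduced w" by (auto simp: free_group_def)
    then show "w \<in> generate (free_group A) ((\<lambda>x. [(x, True)]) ` A)"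
    proof (induction w)
      case Nil
      have "\<one>\<^bsub>free_group A\<^esub> = []" by (simp add: free_group_def)
      then show ?case by (metis generate.one)
    next
      case (Cons a w)
      have "a # w = [a] \<otimes>\<^bsub>free_group A\<^esub> w"
        using Cons.prems by (cases w) (auto simp: free_group_def freely_reduced_Cons)
      moreover have "[a] \<in> generate (free_group A) ((\<lambda>x. [(x, True)]) ` A)"
        using Cons.prems letter by (cases a) auto
      moreover have "w \<in> generate (free_group A) ((\<lambda>x. [(x, True)]) ` A)"
        using Cons by (simp add: freely_reduced_Cons)
      ultimately show ?case by (simp only: generate.eng)
    qed
  qed
qed

lemma generate_free_nilpotent:
  "generate (free_nilpotent n r) (free_nilpotent_basis n r) = carrier (free_nilpotent n r)"
proof -
  let ?F = "free_group {1..n}" and ?N = "lower_central (free_group {1..n}) (r + 1)"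
  interpret F: group ?F by (rule group_free_group)
  interpret N: normal ?N ?F by (rule F.lower_central_normal)
  interpret \<pi>: group_hom ?F "?F Mod ?N" "(#>\<^bsub>?F\<^esub>) ?N"
    by (intro group_hom.intro group_hom_axioms.intro F.is_group N.factorgroup_is_group N.r_coset_hom_Mod)
  have "(\<lambda>i. [(i, True)]) ` {1..n} \<subseteq> carrier ?F"
    by (auto simp: free_group_def freely_reduced_Cons)
  from \<pi>.generate_img[OF this] show ?thesis
    unfolding generate_free_group free_nilpotent_def free_nilpotent_basis_def
    by (auto simp: image_image FactGroup_def RCOSETS_def)
qed

end

theory Submission
  imports Defs
begin

text \<open>The lower bound is a parity argument.  A palindrome is \<open>w w'\<close> or \<open>w t w'\<close>, where \<open>w'\<close> is the reversal of the word
  \<open>w\<close> and \<open>t\<close> is a letter.  When the generators are mapped to involutions, \<open>w'\<close> becomes the inverse of \<open>w\<close>, so in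
  such a quotient the palindrome depends, up to conjugation, on its middle letter alone.  The dihedral group of order eight is
  generated by two non-commuting involutions and has class two, so it is a quotient of every free nilpotent group of class
  at least two in many ways.  Testing \<open>(x\<^sub>1 \<cdots> x\<^sub>n)\<^sup>2\<close> in these quotients shows that all but at most one of the generators
  must occur as a middle letter, each of them an even number of times, which forces \<open>2 (n - 1)\<close> palindromes
  (\<open>palindromic_width_ge\<close>).

  For the upper bounds, the conjugate \<open>g x g\<^sup>-\<^sup>1\<close> of a generator is a product of two palindromes
  (\<open>conjugate_generator_in_palindrome_products\<close>), and \<open>x\<^sup>k\<close> is a palindrome.  It suffices to write each element as
  \<open>\<Prod>\<^sub>i x\<^sub>i\<^sup>k (g\<^sub>i x\<^sub>i g\<^sub>i\<^sup>-\<^sup>1)\<close>, with exponents \<open>k\<close> depending on \<open>i\<close>.  This is done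
  modulo each term of the lower central series in turn: the error made modulo \<open>\<gamma>\<^sub>c\<close> is, modulo \<open>\<gamma>\<^sub>c\<^sub>+\<^sub>1\<close>, a central product
  \<open>\<Prod>\<^sub>i [h\<^sub>i, x\<^sub>i]\<close>, and replacing \<open>g\<^sub>i\<close> by \<open>g\<^sub>i h\<^sub>i\<close> absorbs it
  (\<open>conjugate_products_mod_lower_central\<close>).

  In class two there is more room.  Collecting the generators one at a time, the commutators \<open>[b, x]\<close> with a fixed
  generator \<open>x\<close> need only conjugators \<open>b\<close> from the subgroup of the generators not yet collected.  So the last generator needs no
  conjugator, and a parity choice lets the last two generators share three palindromes
  (\<open>two_generator_palindrome_products\<close>); the remaining \<open>n - 2\<close> generators cost three each.\<close>

section \<open>Generated subgroups\<close>

lemma (in group) inv_mult_cancel [simp]: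
  "\<lbrakk>x \<in> carrier G; y \<in> carrier G\<rbrakk> \<Longrightarrow> inv x \<otimes> (x \<otimes> y) = y"
  "\<lbrakk>x \<in> carrier G; y \<in> carrier G\<rbrakk> \<Longrightarrow> x \<otimes> (inv x \<otimes> y) = y"
  by (simp_all add: m_assoc [symmetric])

text \<open>Every element of a generated subgroup is a word in the generators and their inverses, so it is
  reached from \<open>\<one>\<close> by multiplying letters on the left.\<close>
lemma (in group) generate_left_induct [consumes 2, case_names one mult inv_mult]:
  assumes g: "g \<in> generate G S" and S: "S \<subseteq> carrier G"
    and one: "P \<one>"
    and mult: "\<And>s h. \<lbrakk>s \<in> S; h \<in> generate G S; P h\<rbrakk> \<Longrightarrow> P (s \<otimes> h)"
    and inv_mult: "\<And>s h. \<lbrakk>s \<in> S; h \<in> generate G S; P h\<rbrakk> \<Longrightarrow> P (inv s \<otimes> h)"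
  shows "P g"
proof -
  have "P (g \<otimes> h)" if "P h" "h \<in> generate G S" for h
    using g that
  proof (induction g arbitrary: h)
    case one
    then show ?case using generate_in_carrier[OF S] by simp
  next
    case (eng g1 g2)
    have "P (g1 \<otimes> (g2 \<otimes> h))" by (intro eng generate.eng)
    then show ?case using eng generate_in_carrier[OF S] by (simp add: m_assoc)
  qed (auto intro: mult inv_mult)
  from this[OF one generate.one] show ?thesis
    using g generate_in_carrier[OF S] by simp
qed

section \<open>Palindromic elements\<close>

lemma (in group) word_value_append:
  "\<lbrakk>fst ` set u \<subseteq> carrier G; fst ` set v \<subseteq> carrier G\<rbrakk> \<Longrightarrow>
   word_value G (u @ v) = word_value G u \<otimes> word_value G v"
proof (induction u)
  case Nil
  then show ?case using word_value_closed[of v] by (simp add: word_value_def list_mult_def)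
qed (simp add: word_value_Cons letter_value_closed word_value_closed m_assoc)

lemma word_value_Nil [simp]: "word_value G [] = \<one>\<^bsub>G\<^esub>"
  by (simp add: word_value_def list_mult_def)

lemma freely_reduced_append:
  "freely_reduced (u @ v) \<longleftrightarrow>
   freely_reduced u \<and> freely_reduced v \<and> (u \<noteq> [] \<longrightarrow> v \<noteq> [] \<longrightarrow> hd v \<noteq> inv_letter (last u))"
  by (auto simp: freely_reduced_def successively_append_iff)

lemma inv_letter_neq [simp]: "inv_letter a \<noteq> a" "a \<noteq> inv_letter a"
  by (cases a; simp add: inv_letter_def)+

lemma (in group) letter_value_inv_letter:
  "fst a \<in> carrier G \<Longrightarrow> letter_value G (inv_letter a) = inv (letter_value G a)"
  by (cases a) (auto simp: inv_letter_def)

text \<open>A palindromic word is built from the empty word or a single letter by putting the same letter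
  at both ends.\<close>
lemma palindrome_cases:
  assumes "rev w = w"
  obtains "w = []" | b where "w = [b]" | b u where "w = b # u @ [b]" "rev u = u"
proof (cases w)
  case Nil
  then show thesis by (rule that(1))
next
  case (Cons b v)
  show thesis
  proof (cases v rule: rev_cases)
    case Nil
    with Cons have "w = [b]" by simp
    then show thesis by (rule that(2))
  next
    case (snoc u c)
    then have w: "w = b # u @ [c]" using Cons by simp
    then have "rev w = c # rev u @ [b]" by simp
    then have "c # rev u @ [b] = b # u @ [c]" using assms w by metis
    then have "c = b" "rev u = u" by (metis list.inject append1_eq_conv)+
    then show thesis using that(3) w by metis
  qed
qed

text \<open>The word \<open>a w a\<close> is a palindrome when \<open>w\<close> is, but it need not be reduced.  It fails to be reduced only
  if \<open>w\<close> starts, and hence also ends, with the inverse of \<open>a\<close>.  Then either \<open>w\<close> is that single letter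
  and \<open>a w a\<close> collapses to \<open>a\<close>, or \<open>a\<close> cancels at both ends and the inner palindrome of \<open>w\<close> remains.
  Because of this lemma, no later argument has to consider reducedness again.\<close>
lemma (in group) palindrome_between_letters:
  assumes S: "S \<subseteq> carrier G" and p: "p \<in> palindromes G S" and a: "fst a \<in> S"
  shows "letter_value G a \<otimes> p \<otimes> letter_value G a \<in> palindromes G S"
proof -
  obtain w where w: "p = word_value G w" "set w \<subseteq> S \<times> UNIV" "freely_reduced w" "rev w = w"
    using p by (auto simp: palindromes_def palindromic_word_def)
  have ac: "fst a \<in> carrier G" and wc: "fst ` set w \<subseteq> carrier G" using S a w(2) by auto
  have aS: "set [a] \<subseteq> S \<times> UNIV" using a by (cases a) auto
  define l where "l = letter_value G a"
  have l: "l \<in> carrier G" using ac by (simp add: letter_value_closed l_def)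
  have "\<exists>v. l \<otimes> p \<otimes> l = word_value G v \<and> set v \<subseteq> S \<times> UNIV \<and> freely_reduced v \<and> rev v = v"
  proof (cases "w \<noteq> [] \<and> hd w = inv_letter a")
    case False
    have "last w = hd w" using w(4) by (metis last_rev)
    then have "freely_reduced (w @ [a])"
      using False w(3) by (auto simp: freely_reduced_Cons freely_reduced_append)
    then have "freely_reduced (a # w @ [a])"
      using False by (auto simp: freely_reduced_Cons hd_append)
    moreover have "word_value G (a # w @ [a]) = l \<otimes> p \<otimes> l"
      using ac wc l w(1) word_value_closed[OF wc]
      by (simp add: word_value_append word_value_Cons l_def m_assoc)
    ultimately show ?thesis using w aS by (intro exI[of _ "a # w @ [a]"]) auto
  next
    case True
    from \<open>rev w = w\<close> show ?thesis
    proof (cases rule: palindrome_cases)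
      case (2 b)
      then show ?thesis using True aS ac l w(1)
        by (intro exI[of _ "[a]"])
          (simp add: freely_reduced_Cons word_value_Cons letter_value_inv_letter flip: l_def)
    next
      case (3 b u)
      have u: "fst ` set u \<subseteq> carrier G" using wc 3 by auto
      have "p = inv l \<otimes> (word_value G u \<otimes> inv l)"
        using True 3 ac u l w(1)
        by (simp add: word_value_append word_value_Cons letter_value_inv_letter flip: l_def)
      then have "l \<otimes> p \<otimes> l = word_value G u"
        using l word_value_closed[OF u] by (simp add: m_assoc)
      then show ?thesis using w 3 by (intro exI[of _ u]) (auto simp: freely_reduced_Cons freely_reduced_append)
    qed (use True in simp)
  qed
  then show ?thesis by (auto simp: palindromes_def palindromic_word_def l_def)
qed

lemma (in group) palindrome_between:
  assumes "S \<subseteq> carrier G" "p \<in> palindromes G S" "s \<in> S"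
  shows "s \<otimes> p \<otimes> s \<in> palindromes G S" "inv s \<otimes> p \<otimes> inv s \<in> palindromes G S"
  using palindrome_between_letters[OF assms(1,2), of "(s, True)"]
    palindrome_between_letters[OF assms(1,2), of "(s, False)"] assms(3) by simp_all

lemma (in group) palindromes_closed:
  "S \<subseteq> carrier G \<Longrightarrow> palindromes G S \<subseteq> carrier G"
  by (auto simp: palindromes_def intro!: word_value_closed)

lemma one_in_palindromes: "\<one>\<^bsub>G\<^esub> \<in> palindromes G S"
  by (auto simp: palindromes_def palindromic_word_def intro!: exI[of _ "[]"])

lemma (in group) generator_in_palindromes:
  assumes "S \<subseteq> carrier G" "s \<in> S"
  shows "s \<in> palindromes G S" "inv s \<in> palindromes G S"
proof -
  have "[(s, b)] \<in> {w. set w \<subseteq> S \<times> UNIV \<and> palindromic_word w}" for b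
    using assms by (simp add: palindromic_word_def freely_reduced_Cons)
  then have "word_value G [(s, b)] \<in> palindromes G S" for b
    unfolding palindromes_def by blast
  from this[of True] this[of False] show "s \<in> palindromes G S" "inv s \<in> palindromes G S"
    using assms by (auto simp: word_value_Cons subset_iff)
qed

text \<open>If \<open>w\<close> is a word for \<open>g\<close> and \<open>r\<close> is the value of the reversed word, then \<open>w p w'\<close> is a palindrome for each
  palindrome \<open>p\<close>, and \<open>(w')\<^sup>-\<^sup>1 w\<^sup>-\<^sup>1\<close> is a palindrome too.  Here \<open>w'\<close> stands for the reversed word.  In general \<open>r\<close> depends on
  the word and not on \<open>g\<close> alone, hence the existential quantifier.\<close>
lemma (in group) palindrome_conjugator:
  assumes "S \<subseteq> carrier G" "g \<in> generate G S"
  shows "\<exists>r\<in>carrier G. (\<forall>p\<in>palindromes G S. g \<otimes> p \<otimes> r \<in> palindromes G S) \<and>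
           inv r \<otimes> inv g \<in> palindromes G S"
  using assms(2,1)
proof (induction rule: generate_left_induct)
  case one
  have "palindromes G S \<subseteq> carrier G" using assms(1) by (rule palindromes_closed)
  then show ?case by (intro bexI[of _ \<one>]) (auto simp: one_in_palindromes subset_iff)
next
  case (mult s h)
  then obtain r where r: "r \<in> carrier G" "\<forall>p\<in>palindromes G S. h \<otimes> p \<otimes> r \<in> palindromes G S"
    "inv r \<otimes> inv h \<in> palindromes G S" by blast
  have c: "h \<in> carrier G" "s \<in> carrier G" using mult assms(1) generate_in_carrier[of S] by auto
  have "s \<otimes> h \<otimes> p \<otimes> (r \<otimes> s) \<in> palindromes G S" if "p \<in> palindromes G S" for p
  proof -
    have "p \<in> carrier G" using that palindromes_closed[OF assms(1)] by auto
    then show ?thesis using palindrome_between(1)[OF assms(1) r(2)[rule_format, OF that] \<open>s \<in> S\<close>] r(1) c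
      by (simp add: m_assoc)
  qed
  moreover have "inv (r \<otimes> s) \<otimes> inv (s \<otimes> h) \<in> palindromes G S"
    using palindrome_between(2)[OF \<open>S \<subseteq> carrier G\<close> r(3) \<open>s \<in> S\<close>] r c
    by (simp add: m_assoc inv_mult_group)
  ultimately show ?case using r c by (intro bexI[of _ "r \<otimes> s"]) auto
next
  case (inv_mult s h)
  then obtain r where r: "r \<in> carrier G" "\<forall>p\<in>palindromes G S. h \<otimes> p \<otimes> r \<in> palindromes G S"
    "inv r \<otimes> inv h \<in> palindromes G S" by blast
  have c: "h \<in> carrier G" "s \<in> carrier G" using inv_mult assms(1) generate_in_carrier[of S] by auto
  have "inv s \<otimes> h \<otimes> p \<otimes> (r \<otimes> inv s) \<in> palindromes G S" if "p \<in> palindromes G S" for p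
  proof -
    have "p \<in> carrier G" using that palindromes_closed[OF assms(1)] by auto
    then show ?thesis
      using palindrome_between(2)[OF assms(1) r(2)[rule_format, OF that] \<open>s \<in> S\<close>] r(1) c
      by (simp add: m_assoc)
  qed
  moreover have "inv (r \<otimes> inv s) \<otimes> inv (inv s \<otimes> h) \<in> palindromes G S"
    using palindrome_between(1)[OF \<open>S \<subseteq> carrier G\<close> r(3) \<open>s \<in> S\<close>] r c
    by (simp add: m_assoc inv_mult_group)
  ultimately show ?case using r c by (intro bexI[of _ "r \<otimes> inv s"]) auto
qed

lemma (in group) palindrome_between_powers:
  assumes "S \<subseteq> carrier G" "p \<in> palindromes G S" "s \<in> S"
  shows "s [^] (k::int) \<otimes> p \<otimes> s [^] k \<in> palindromes G S"
proof -
  have c: "s \<in> carrier G" "p \<in> carrier G" using assms palindromes_closed by auto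
  show ?thesis
  proof (induction k rule: int_induct[where k = 0])
    case base
    then show ?case using assms c by simp
  next
    case (step1 i)
    have "s [^] (i + 1) = s \<otimes> s [^] i" "s [^] (i + 1) = s [^] i \<otimes> s"
      using int_pow_mult[of s 1 i] int_pow_mult[of s i 1] c by (simp_all add: add.commute)
    then have "s [^] (i + 1) \<otimes> p \<otimes> s [^] (i + 1) = s \<otimes> (s [^] i \<otimes> p \<otimes> s [^] i) \<otimes> s"
      using c by (metis int_pow_closed m_assoc m_closed)
    then show ?case using palindrome_between(1) assms step1 by simp
  next
    case (step2 i)
    have "s [^] (i - 1) = inv s \<otimes> s [^] i" "s [^] (i - 1) = s [^] i \<otimes> inv s"
      using int_pow_mult[of s "-1" i] int_pow_mult[of s i "-1"] c by (simp_all add: int_pow_neg)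
    then have "s [^] (i - 1) \<otimes> p \<otimes> s [^] (i - 1) = inv s \<otimes> (s [^] i \<otimes> p \<otimes> s [^] i) \<otimes> inv s"
      using c by (metis int_pow_closed m_assoc m_closed inv_closed)
    then show ?case using palindrome_between(2) assms step2 by simp
  qed
qed

lemma (in group) power_in_palindromes:
  assumes "S \<subseteq> carrier G" "s \<in> S"
  shows "s [^] (k::int) \<in> palindromes G S"
proof -
  have c: "s \<in> carrier G" using assms by auto
  show ?thesis
  proof (cases "even k")
    case True
    then obtain j where k: "k = j + j" by (metis evenE mult_2)
    show ?thesis
      using palindrome_between_powers[OF assms(1) one_in_palindromes assms(2), of j] c
      by (metis int_pow_closed int_pow_mult k r_one)
  next
    case False
    then obtain j where k: "k = j + 1 + j" by (metis oddE mult_2 add.commute add.left_commute)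
    show ?thesis
      using palindrome_between_powers[OF assms(1) generator_in_palindromes(1)[OF assms] assms(2), of j] c
      by (metis int_pow_1 int_pow_closed int_pow_mult k)
  qed
qed

section \<open>Products of palindromes\<close>

text \<open>Exactly \<open>k\<close> factors amount to at most \<open>k\<close> factors, as the empty word is a palindrome; the exact number makes
  the sets multiply without bookkeeping.\<close>
definition palindrome_products :: "('a, 'm) monoid_scheme \<Rightarrow> 'a set \<Rightarrow> nat \<Rightarrow> 'a set" where
  "palindrome_products G S k = {list_mult G ps | ps. set ps \<subseteq> palindromes G S \<and> length ps = k}"

lemma list_mult_simps [simp]:
  "list_mult G [] = \<one>\<^bsub>G\<^esub>" "list_mult G (x # xs) = x \<otimes>\<^bsub>G\<^esub> list_mult G xs"
  by (simp_all add: list_mult_def)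

lemma (in group) list_mult_closed: "set ps \<subseteq> carrier G \<Longrightarrow> list_mult G ps \<in> carrier G"
  by (induction ps) auto

lemma (in group) list_mult_append:
  "\<lbrakk>set ps \<subseteq> carrier G; set qs \<subseteq> carrier G\<rbrakk> \<Longrightarrow>
   list_mult G (ps @ qs) = list_mult G ps \<otimes> list_mult G qs"
  by (induction ps) (auto simp: list_mult_closed m_assoc)

lemma (in group) palindrome_products_mult:
  assumes "S \<subseteq> carrier G" "g \<in> palindrome_products G S k" "h \<in> palindrome_products G S l"
  shows "g \<otimes> h \<in> palindrome_products G S (k + l)"
proof -
  obtain ps qs where "g = list_mult G ps" "set ps \<subseteq> palindromes G S" "length ps = k"
    "h = list_mult G qs" "set qs \<subseteq> palindromes G S" "length qs = l"
    using assms by (auto simp: palindrome_products_def)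
  moreover from this have "list_mult G (ps @ qs) = list_mult G ps \<otimes> list_mult G qs"
    using palindromes_closed[OF assms(1)] by (intro list_mult_append) auto
  ultimately show ?thesis unfolding palindrome_products_def by (intro CollectI exI[of _ "ps @ qs"]) auto
qed

lemma (in group) palindrome_products_1:
  assumes "S \<subseteq> carrier G"
  shows "palindrome_products G S 1 = palindromes G S"
proof
  show "palindrome_products G S 1 \<subseteq> palindromes G S"
    using palindromes_closed[OF assms] by (auto simp: palindrome_products_def length_Suc_conv subset_iff)
  show "palindromes G S \<subseteq> palindrome_products G S 1"
  proof
    fix p assume "p \<in> palindromes G S"
    then show "p \<in> palindrome_products G S 1"
      using palindromes_closed[OF assms] unfolding palindrome_products_def
      by (intro CollectI exI[of _ "[p]"]) auto
  qed
qed

text \<open>A conjugate \<open>g s g\<^sup>-\<^sup>1\<close> splits as \<open>(g s r) (r\<^sup>-\<^sup>1 g\<^sup>-\<^sup>1)\<close>, and both factors are palindromes when \<open>r\<close> is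
  the value of a reversed word for \<open>g\<close>.  All upper bounds rest on this observation.\<close>
lemma (in group) conjugate_generator_in_palindrome_products:
  assumes "S \<subseteq> carrier G" "s \<in> S" "g \<in> generate G S"
  shows "g \<otimes> s \<otimes> inv g \<in> palindrome_products G S 2"
proof -
  obtain r where r: "r \<in> carrier G" "g \<otimes> s \<otimes> r \<in> palindromes G S" "inv r \<otimes> inv g \<in> palindromes G S"
    using palindrome_conjugator[OF assms(1,3)] generator_in_palindromes(1)[OF assms(1,2)] by blast
  have "g \<otimes> s \<otimes> inv g = (g \<otimes> s \<otimes> r) \<otimes> (inv r \<otimes> inv g)"
    using assms r generate_in_carrier[OF assms(1,3)] by (simp add: m_assoc subset_iff)
  then show ?thesis
    using palindrome_products_mult[OF assms(1), of _ 1 _ 1] r palindrome_products_1[OF assms(1)]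
    by (simp add: numeral_2_eq_2)
qed

lemma palindromic_width_le:
  assumes "\<And>g. g \<in> carrier G \<Longrightarrow> g \<in> palindrome_products G S k"
  shows "palindromic_width G S \<le> enat k"
  unfolding palindromic_width_def
proof (rule SUP_least)
  fix g assume "g \<in> carrier G"
  from assms[OF this] obtain ps where "set ps \<subseteq> palindromes G S" "length ps = k" "list_mult G ps = g"
    by (auto simp: palindrome_products_def)
  then show "palindromic_length G S g \<le> enat k"
    unfolding palindromic_length_def by (intro Inf_lower) auto
qed

section \<open>Central commutators\<close>

definition commutator :: "('a, 'm) monoid_scheme \<Rightarrow> 'a \<Rightarrow> 'a \<Rightarrow> 'a" where
  "commutator G x y = x \<otimes>\<^bsub>G\<^esub> y \<otimes>\<^bsub>G\<^esub> inv\<^bsub>G\<^esub> x \<otimes>\<^bsub>G\<^esub> inv\<^bsub>G\<^esub> y"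

definition center :: "('a, 'm) monoid_scheme \<Rightarrow> 'a set" where
  "center G = {z \<in> carrier G. \<forall>g\<in>carrier G. z \<otimes>\<^bsub>G\<^esub> g = g \<otimes>\<^bsub>G\<^esub> z}"

context group
begin

lemma center_closed [simp]: "z \<in> center G \<Longrightarrow> z \<in> carrier G"
  by (simp add: center_def)

lemma center_commute: "\<lbrakk>z \<in> center G; g \<in> carrier G\<rbrakk> \<Longrightarrow> z \<otimes> g = g \<otimes> z"
  unfolding center_def by blast

lemma center_left_commute:
  "\<lbrakk>z \<in> center G; g \<in> carrier G; h \<in> carrier G\<rbrakk> \<Longrightarrow> g \<otimes> (z \<otimes> h) = z \<otimes> (g \<otimes> h)"
  by (metis center_closed center_commute m_assoc)

lemma one_center: "\<one> \<in> center G"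
  unfolding center_def by auto

lemma center_mult: "\<lbrakk>z \<in> center G; w \<in> center G\<rbrakk> \<Longrightarrow> z \<otimes> w \<in> center G"
proof -
  assume z: "z \<in> center G" "w \<in> center G"
  have "z \<otimes> w \<otimes> g = g \<otimes> (z \<otimes> w)" if "g \<in> carrier G" for g
  proof -
    have "z \<otimes> w \<otimes> g = z \<otimes> (g \<otimes> w)"
      using z that center_commute[OF z(2) that] by (simp add: m_assoc)
    also have "\<dots> = g \<otimes> (z \<otimes> w)" using z that by (intro center_left_commute [symmetric]) simp_all
    finally show ?thesis .
  qed
  then show ?thesis using z unfolding center_def by blast
qed

lemma commutator_closed [simp]:
  "\<lbrakk>x \<in> carrier G; y \<in> carrier G\<rbrakk> \<Longrightarrow> commutator G x y \<in> carrier G"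
  by (simp add: commutator_def)

lemma mult_eq_commutator:
  "\<lbrakk>x \<in> carrier G; y \<in> carrier G\<rbrakk> \<Longrightarrow> x \<otimes> y = commutator G x y \<otimes> (y \<otimes> x)"
  by (simp add: commutator_def m_assoc)

lemma commutator_one [simp]:
  "x \<in> carrier G \<Longrightarrow> commutator G \<one> x = \<one>" "x \<in> carrier G \<Longrightarrow> commutator G x \<one> = \<one>"
  by (simp_all add: commutator_def)

lemma inv_commutator:
  "\<lbrakk>x \<in> carrier G; y \<in> carrier G\<rbrakk> \<Longrightarrow> inv (commutator G x y) = commutator G y x"
  by (simp add: commutator_def inv_mult_group m_assoc)

text \<open>The map \<open>(x, y) \<mapsto> [x, y]\<close> is multiplicative in each argument as far as its values are central.\<close>
lemma commutator_mult_left: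
  assumes "x \<in> carrier G" "x' \<in> carrier G" "y \<in> carrier G" "commutator G x' y \<in> center G"
  shows "commutator G (x \<otimes> x') y = commutator G x y \<otimes> commutator G x' y"
proof -
  have "commutator G (x \<otimes> x') y = x \<otimes> (commutator G x' y \<otimes> (y \<otimes> (inv x \<otimes> inv y)))"
    using assms(1-3) by (simp add: commutator_def inv_mult_group m_assoc)
  also have "\<dots> = commutator G x' y \<otimes> (x \<otimes> (y \<otimes> (inv x \<otimes> inv y)))"
    by (rule center_left_commute) (use assms in simp_all)
  also have "\<dots> = commutator G x' y \<otimes> commutator G x y"
    using assms(1,3) by (simp add: commutator_def[of G x y] m_assoc)
  also have "\<dots> = commutator G x y \<otimes> commutator G x' y"
    by (rule center_commute) (use assms in simp_all)
  finally show ?thesis .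
qed

lemma commutator_mult_right:
  assumes "x \<in> carrier G" "y \<in> carrier G" "y' \<in> carrier G" "commutator G x y' \<in> center G"
  shows "commutator G x (y \<otimes> y') = commutator G x y \<otimes> commutator G x y'"
proof -
  have "commutator G x (y \<otimes> y') = (x \<otimes> y \<otimes> inv x) \<otimes> (commutator G x y' \<otimes> inv y)"
    using assms(1-3) by (simp add: commutator_def inv_mult_group m_assoc)
  also have "\<dots> = commutator G x y' \<otimes> ((x \<otimes> y \<otimes> inv x) \<otimes> inv y)"
    by (rule center_left_commute) (use assms in simp_all)
  also have "\<dots> = commutator G x y' \<otimes> commutator G x y"
    by (simp add: commutator_def[of G x y])
  also have "\<dots> = commutator G x y \<otimes> commutator G x y'"
    by (rule center_commute) (use assms in simp_all)
  finally show ?thesis .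
qed

lemma commutator_inv_left:
  assumes "x \<in> carrier G" "y \<in> carrier G" "commutator G x y \<in> center G"
  shows "commutator G (inv x) y = inv (commutator G x y)"
proof (rule inv_equality [symmetric])
  show "commutator G (inv x) y \<otimes> commutator G x y = \<one>"
    using commutator_mult_left[of "inv x" x y] assms by simp
qed (use assms in simp_all)

lemma commutator_inv_right:
  assumes "x \<in> carrier G" "y \<in> carrier G" "commutator G x y \<in> center G"
  shows "commutator G x (inv y) = inv (commutator G x y)"
proof (rule inv_equality [symmetric])
  show "commutator G x (inv y) \<otimes> commutator G x y = \<one>"
    using commutator_mult_right[of x "inv y" y] assms by simp
qed (use assms in simp_all)

end

section \<open>Absorbing central commutators into conjugates\<close>

fun commutator_products :: "('a, 'm) monoid_scheme \<Rightarrow> 'a set \<Rightarrow> 'a list \<Rightarrow> 'a set" where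
  "commutator_products G H [] = {\<one>\<^bsub>G\<^esub>}"
| "commutator_products G H (x # xs) =
     {commutator G h x \<otimes>\<^bsub>G\<^esub> c | h c. h \<in> H \<and> c \<in> commutator_products G H xs}"

lemma commutator_products_ConsI:
  "\<lbrakk>h \<in> H; c \<in> commutator_products G H xs\<rbrakk> \<Longrightarrow>
   commutator G h x \<otimes>\<^bsub>G\<^esub> c \<in> commutator_products G H (x # xs)"
  by auto

text \<open>The shape in which elements of a nilpotent group are written.  In each factor \<open>x\<^sup>k (g x g\<^sup>-\<^sup>1)\<close> the
  exponent \<open>k\<close> adjusts the image in the abelianization, and the conjugator \<open>g\<close> absorbs commutators; the factor
  costs one palindrome for the power and two for the conjugate.\<close>
fun conjugate_products :: "('a, 'm) monoid_scheme \<Rightarrow> 'a list \<Rightarrow> 'a set" where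
  "conjugate_products G [] = {\<one>\<^bsub>G\<^esub>}"
| "conjugate_products G (x # xs) =
     {x [^]\<^bsub>G\<^esub> k \<otimes>\<^bsub>G\<^esub> (g \<otimes>\<^bsub>G\<^esub> x \<otimes>\<^bsub>G\<^esub> inv\<^bsub>G\<^esub> g) \<otimes>\<^bsub>G\<^esub> s |
      (k :: int) g s. g \<in> carrier G \<and> s \<in> conjugate_products G xs}"

context group
begin

lemma conjugate_products_closed:
  "set xs \<subseteq> carrier G \<Longrightarrow> conjugate_products G xs \<subseteq> carrier G"
  by (induction xs) auto

lemma commutator_products_subset_center:
  assumes "\<And>h x. \<lbrakk>h \<in> H; x \<in> set xs\<rbrakk> \<Longrightarrow> commutator G h x \<in> center G"
  shows "commutator_products G H xs \<subseteq> center G"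
  using assms
proof (induction xs)
  case Nil
  then show ?case using one_center by simp
next
  case (Cons x xs)
  have "commutator G h x \<otimes> c \<in> center G" if "h \<in> H" "c \<in> commutator_products G H xs" for h c
  proof -
    have "commutator G h x \<in> center G" "c \<in> center G" using Cons that by auto
    then show ?thesis by (rule center_mult)
  qed
  then show ?case by auto
qed

lemma commutator_products_mult:
  assumes H: "subgroup H G" and "set xs \<subseteq> carrier G"
    and "\<And>h x. \<lbrakk>h \<in> H; x \<in> set xs\<rbrakk> \<Longrightarrow> commutator G h x \<in> center G"
    and "c \<in> commutator_products G H xs" "d \<in> commutator_products G H xs"
  shows "c \<otimes> d \<in> commutator_products G H xs"
  using assms(2-)
proof (induction xs arbitrary: c d)
  case Nil
  then show ?case by simp
next
  case (Cons x xs)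
  then obtain h c' k d' where h: "c = commutator G h x \<otimes> c'" "d = commutator G k x \<otimes> d'"
    "h \<in> H" "k \<in> H" "c' \<in> commutator_products G H xs" "d' \<in> commutator_products G H xs"
    by auto
  have cl: "h \<in> carrier G" "k \<in> carrier G" "x \<in> carrier G"
    using h H Cons.prems subgroup.mem_carrier by auto
  have z: "commutator G h x \<in> center G" "commutator G k x \<in> center G" using Cons.prems h by auto
  have z': "c' \<in> center G" "d' \<in> center G"
    using commutator_products_subset_center[of H xs] Cons.prems h by auto
  have "c' \<otimes> (commutator G k x \<otimes> d') = commutator G k x \<otimes> (c' \<otimes> d')"
    by (rule center_left_commute) (use z z' in simp_all)
  then have "c \<otimes> d = commutator G (h \<otimes> k) x \<otimes> (c' \<otimes> d')"
    using cl z z' by (simp add: h(1,2) commutator_mult_left m_assoc)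
  moreover have "c' \<otimes> d' \<in> commutator_products G H xs" using Cons h by simp
  moreover have "h \<otimes> k \<in> H" using h H by (simp add: subgroup.m_closed)
  ultimately show ?case by (simp only: commutator_products_ConsI)
qed

lemma one_in_commutator_products:
  "\<lbrakk>subgroup H G; set xs \<subseteq> carrier G\<rbrakk> \<Longrightarrow> \<one> \<in> commutator_products G H xs"
proof (induction xs)
  case (Cons x xs)
  have "commutator G \<one> x \<otimes> \<one> \<in> commutator_products G H (x # xs)"
    using Cons subgroup.one_closed[OF Cons.prems(1)]
    by (intro commutator_products_ConsI) simp_all
  then show ?case using Cons.prems by simp
qed simp

lemma commutator_in_commutator_products:
  assumes H: "subgroup H G" and "set xs \<subseteq> carrier G" and h: "h \<in> H" and "x \<in> set xs"
  shows "commutator G h x \<in> commutator_products G H xs"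
  using assms(2,4)
proof (induction xs)
  case (Cons y xs)
  have hc: "h \<in> carrier G" using H h by (rule subgroup.mem_carrier)
  show ?case
  proof (cases "x = y")
    case True
    have "commutator G h y \<otimes> \<one> \<in> commutator_products G H (y # xs)"
      using h one_in_commutator_products[OF H, of xs] Cons.prems
      by (intro commutator_products_ConsI) simp_all
    then show ?thesis using True hc Cons.prems(1) by simp
  next
    case False
    then have "commutator G \<one> y \<otimes> commutator G h x \<in> commutator_products G H (y # xs)"
      using Cons subgroup.one_closed[OF H] by (intro commutator_products_ConsI) simp_all
    moreover have "x \<in> carrier G" "y \<in> carrier G" using Cons.prems by auto
    ultimately show ?thesis using hc by simp
  qed
qed simp

text \<open>If \<open>[H, G]\<close> is central, the pairing \<open>H \<times> G \<rightarrow> [H, G]\<close> is bimultiplicative.  Thus \<open>[H, G]\<close> is generated by the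
  elements \<open>[h, x]\<close> with \<open>x\<close> a generator of \<open>G\<close>, and for each \<open>x\<close> the factors \<open>[h, x]\<close> merge into a single
  one.\<close>
lemma generate_commutators_subset:
  assumes H: "subgroup H G" and xs: "set xs \<subseteq> carrier G" "generate G (set xs) = carrier G"
    and cen: "\<And>h g. \<lbrakk>h \<in> H; g \<in> carrier G\<rbrakk> \<Longrightarrow> commutator G h g \<in> center G"
  shows "generate G {commutator G h g | h g. h \<in> H \<and> g \<in> carrier G} \<subseteq> commutator_products G H xs"
proof
  let ?C = "commutator_products G H xs"
  have Hc: "h \<in> carrier G" if "h \<in> H" for h using H that by (rule subgroup.mem_carrier)
  have prod_closed: "c \<otimes> d \<in> ?C" if "c \<in> ?C" "d \<in> ?C" for c d
    using commutator_products_mult[OF H xs(1)] cen xs that by blast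
  have comm: "commutator G h g \<in> ?C" if "h \<in> H" "g \<in> carrier G" for h g
    using that(2,1) unfolding xs(2)[symmetric]
  proof (induction rule: generate_left_induct[OF _ xs(1), consumes 1, case_names one mult inv_mult])
    case one
    then show ?case using one_in_commutator_products[OF H xs(1)] Hc by simp
  next
    case (mult s g)
    then have "s \<in> carrier G" "g \<in> carrier G" using xs by auto
    then have "commutator G h (s \<otimes> g) = commutator G h s \<otimes> commutator G h g"
      using Hc cen \<open>h \<in> H\<close> by (intro commutator_mult_right) auto
    then show ?case using mult commutator_in_commutator_products[OF H xs(1)] prod_closed by auto
  next
    case (inv_mult s g)
    then have c: "s \<in> carrier G" "g \<in> carrier G" "h \<in> carrier G" using xs Hc by auto
    then have "commutator G h (inv s \<otimes> g) = commutator G h (inv s) \<otimes> commutator G h g"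
      using Hc cen \<open>h \<in> H\<close> by (intro commutator_mult_right) auto
    moreover have "commutator G h (inv s) = commutator G (inv h) s"
      using c cen \<open>h \<in> H\<close> by (simp add: commutator_inv_left commutator_inv_right)
    moreover have "inv h \<in> H" using H \<open>h \<in> H\<close> by (rule subgroup.m_inv_closed)
    ultimately show ?case using inv_mult commutator_in_commutator_products[OF H xs(1)] prod_closed by auto
  qed
  fix c assume "c \<in> generate G {commutator G h g | h g. h \<in> H \<and> g \<in> carrier G}"
  then show "c \<in> ?C"
  proof (induction rule: generate.induct)
    case one
    show ?case using one_in_commutator_products[OF H xs(1)] .
  next
    case (incl c)
    then show ?case using comm by auto
  next
    case (inv c)
    then obtain h g where c: "c = commutator G h g" "h \<in> H" "g \<in> carrier G" by auto
    then have "inv c = commutator G (inv h) g" using Hc cen by (simp add: commutator_inv_left)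
    then show ?case using c H comm by (simp add: subgroup.m_inv_closed)
  qed (rule prod_closed)
qed

text \<open>Since \<open>[h, x] x = h x h\<^sup>-\<^sup>1\<close>, a central commutator \<open>[h, x]\<close> disappears into the factor \<open>g x g\<^sup>-\<^sup>1\<close> when the
  conjugator \<open>g\<close> is replaced by \<open>g h\<close>.  The number of factors stays the same.\<close>
lemma conjugate_products_absorb:
  assumes "H \<subseteq> carrier G" "set xs \<subseteq> carrier G"
    and "\<And>h x. \<lbrakk>h \<in> H; x \<in> set xs\<rbrakk> \<Longrightarrow> commutator G h x \<in> center G"
    and "s \<in> conjugate_products G xs" "c \<in> commutator_products G H xs"
  shows "s \<otimes> c \<in> conjugate_products G xs"
  using assms(2-)
proof (induction xs arbitrary: s c)
  case Nil
  then show ?case by simp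
next
  case (Cons x xs)
  then obtain k :: int and g s' h c' where
    s: "s = x [^] k \<otimes> (g \<otimes> x \<otimes> inv g) \<otimes> s'" "g \<in> carrier G" "s' \<in> conjugate_products G xs" and
    c: "c = commutator G h x \<otimes> c'" "h \<in> H" "c' \<in> commutator_products G H xs"
    by auto
  let ?z = "commutator G h x"
  have cl: "x \<in> carrier G" "h \<in> carrier G" "s' \<in> carrier G"
    using Cons.prems assms(1) s c conjugate_products_closed[of xs] by auto
  have z: "?z \<in> center G" "c' \<in> center G"
    using Cons.prems c commutator_products_subset_center[of H xs] by auto
  have "?z \<otimes> x = h \<otimes> x \<otimes> inv h" using cl by (simp add: commutator_def m_assoc)
  then have "g \<otimes> h \<otimes> x \<otimes> inv (g \<otimes> h) = g \<otimes> (?z \<otimes> x) \<otimes> inv g"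
    using cl s by (simp add: inv_mult_group m_assoc)
  moreover have "s' \<otimes> (?z \<otimes> c') = ?z \<otimes> (s' \<otimes> c')"
    "inv g \<otimes> (?z \<otimes> (s' \<otimes> c')) = ?z \<otimes> (inv g \<otimes> (s' \<otimes> c'))"
    "x \<otimes> (?z \<otimes> (inv g \<otimes> (s' \<otimes> c'))) = ?z \<otimes> (x \<otimes> (inv g \<otimes> (s' \<otimes> c')))"
    using cl s(2) z by (auto intro: center_left_commute)
  ultimately have "s \<otimes> c = x [^] k \<otimes> (g \<otimes> h \<otimes> x \<otimes> inv (g \<otimes> h)) \<otimes> (s' \<otimes> c')"
    using cl s(2) z by (simp add: s(1) c(1) m_assoc)
  moreover have "s' \<otimes> c' \<in> conjugate_products G xs" using Cons s c by simp
  moreover have "g \<otimes> h \<in> carrier G" using s cl by simp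
  ultimately show ?case by auto
qed

end

section \<open>Approximation along the lower central series\<close>

lemma (in group_hom) hom_commutator:
  "\<lbrakk>x \<in> carrier G; y \<in> carrier G\<rbrakk> \<Longrightarrow> h (commutator G x y) = commutator H (h x) (h y)"
  by (simp add: commutator_def)

lemma (in group_hom) hom_eq_iff:
  assumes "x \<in> carrier G" "y \<in> carrier G"
  shows "h x = h y \<longleftrightarrow> h (inv\<^bsub>G\<^esub> x \<otimes>\<^bsub>G\<^esub> y) = \<one>\<^bsub>H\<^esub>"
proof
  assume "h (inv\<^bsub>G\<^esub> x \<otimes>\<^bsub>G\<^esub> y) = \<one>\<^bsub>H\<^esub>"
  then have "h (x \<otimes>\<^bsub>G\<^esub> (inv\<^bsub>G\<^esub> x \<otimes>\<^bsub>G\<^esub> y)) = h x"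
    using assms by (subst hom_mult) simp_all
  then show "h x = h y" using assms by simp
qed (use assms in simp)

lemma conjugate_products_ConsI:
  "\<lbrakk>g \<in> carrier G; s \<in> conjugate_products G xs\<rbrakk> \<Longrightarrow>
   x [^]\<^bsub>G\<^esub> (k :: int) \<otimes>\<^bsub>G\<^esub> (g \<otimes>\<^bsub>G\<^esub> x \<otimes>\<^bsub>G\<^esub> inv\<^bsub>G\<^esub> g) \<otimes>\<^bsub>G\<^esub> s \<in> conjugate_products G (x # xs)"
  by auto

lemma (in group_hom) conjugate_products_lift:
  assumes "h ` carrier G = carrier H" "set xs \<subseteq> carrier G" "q \<in> conjugate_products H (map h xs)"
  shows "\<exists>s\<in>conjugate_products G xs. h s = q"
  using assms(2,3)
proof (induction xs arbitrary: q)
  case (Cons x xs)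
  then obtain k :: int and g' q' where q:
    "q = h x [^]\<^bsub>H\<^esub> k \<otimes>\<^bsub>H\<^esub> (g' \<otimes>\<^bsub>H\<^esub> h x \<otimes>\<^bsub>H\<^esub> inv\<^bsub>H\<^esub> g') \<otimes>\<^bsub>H\<^esub> q'"
    "g' \<in> carrier H" "q' \<in> conjugate_products H (map h xs)" by auto
  obtain g where g: "g \<in> carrier G" "h g = g'" using q(2) assms(1) by (metis imageE)
  obtain s where s: "s \<in> conjugate_products G xs" "h s = q'" using Cons q(3) by auto
  have sc: "s \<in> carrier G" using s G.conjugate_products_closed[of xs] Cons.prems by auto
  have "h (x [^]\<^bsub>G\<^esub> k \<otimes>\<^bsub>G\<^esub> (g \<otimes>\<^bsub>G\<^esub> x \<otimes>\<^bsub>G\<^esub> inv\<^bsub>G\<^esub> g) \<otimes>\<^bsub>G\<^esub> s) = q"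
    using Cons.prems(1) g s sc q(1) by (simp add: hom_int_pow)
  moreover have "x [^]\<^bsub>G\<^esub> k \<otimes>\<^bsub>G\<^esub> (g \<otimes>\<^bsub>G\<^esub> x \<otimes>\<^bsub>G\<^esub> inv\<^bsub>G\<^esub> g) \<otimes>\<^bsub>G\<^esub> s \<in> conjugate_products G (x # xs)"
    using g s by auto
  ultimately show ?case by blast
qed simp

lemma (in group_hom) conjugate_products_image:
  assumes "set xs \<subseteq> carrier G" "s \<in> conjugate_products G xs"
  shows "h s \<in> conjugate_products H (map h xs)"
  using assms
proof (induction xs arbitrary: s)
  case (Cons x xs)
  then obtain k :: int and g t where s:
    "s = x [^]\<^bsub>G\<^esub> k \<otimes>\<^bsub>G\<^esub> (g \<otimes>\<^bsub>G\<^esub> x \<otimes>\<^bsub>G\<^esub> inv\<^bsub>G\<^esub> g) \<otimes>\<^bsub>G\<^esub> t"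
    "g \<in> carrier G" "t \<in> conjugate_products G xs" by auto
  have tc: "t \<in> carrier G" using s G.conjugate_products_closed[of xs] Cons.prems by auto
  have "h s = h x [^]\<^bsub>H\<^esub> k \<otimes>\<^bsub>H\<^esub> (h g \<otimes>\<^bsub>H\<^esub> h x \<otimes>\<^bsub>H\<^esub> inv\<^bsub>H\<^esub> h g) \<otimes>\<^bsub>H\<^esub> h t"
    using Cons.prems(1) s tc by (simp add: hom_int_pow)
  moreover have "h t \<in> conjugate_products H (map h xs)" using Cons s by simp
  moreover have "h g \<in> carrier H" using s by simp
  ultimately show ?case by auto
qed simp

context group
begin

lemma one_in_conjugate_products:
  "set xs \<subseteq> carrier G \<Longrightarrow> \<one> \<in> conjugate_products G xs"
proof (induction xs)
  case (Cons x xs)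
  have "x [^] (-1 :: int) \<otimes> (\<one> \<otimes> x \<otimes> inv \<one>) \<otimes> \<one> \<in> conjugate_products G (x # xs)"
    using Cons by (intro conjugate_products_ConsI) simp_all
  moreover have "x [^] (-1 :: int) \<otimes> (\<one> \<otimes> x \<otimes> inv \<one>) \<otimes> \<one> = \<one>"
    using Cons.prems by (simp add: int_pow_neg)
  ultimately show ?case by simp
qed simp

lemma abelian_power_mult_conjugate_products:
  assumes comm: "carrier G \<subseteq> center G" and "set xs \<subseteq> carrier G" "x \<in> set xs"
    "s \<in> conjugate_products G xs"
  shows "x [^] (k :: int) \<otimes> s \<in> conjugate_products G xs"
  using assms(2-)
proof (induction xs arbitrary: s)
  case (Cons y xs)
  then obtain j :: int and g t where s:
    "s = y [^] j \<otimes> (g \<otimes> y \<otimes> inv g) \<otimes> t" "g \<in> carrier G" "t \<in> conjugate_products G xs" by auto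
  have cl: "x \<in> carrier G" "y \<in> carrier G" "t \<in> carrier G"
    using Cons.prems s conjugate_products_closed[of xs] by auto
  show ?case
  proof (cases "x = y")
    case True
    have "x [^] k \<otimes> s = y [^] (k + j) \<otimes> (g \<otimes> y \<otimes> inv g) \<otimes> t"
      using cl s True by (simp add: int_pow_mult m_assoc)
    then show ?thesis using s by auto
  next
    case False
    have "y [^] j \<otimes> (g \<otimes> y \<otimes> inv g) \<in> center G" using comm cl s by auto
    then have "(y [^] j \<otimes> (g \<otimes> y \<otimes> inv g)) \<otimes> (x [^] k \<otimes> t) = x [^] k \<otimes> s"
      using cl s(2) unfolding s(1) by (intro center_left_commute [symmetric]) auto
    moreover have "x [^] k \<otimes> t \<in> conjugate_products G xs" using Cons False s by auto
    ultimately show ?thesis using conjugate_products_ConsI[OF s(2)] by metis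
  qed
qed simp

text \<open>In an abelian group a factor \<open>x\<^sup>k (g x g\<^sup>-\<^sup>1)\<close> is just \<open>x\<^sup>k\<^sup>+\<^sup>1\<close>, so the products in question are all the products of
  powers of the generators.  This starts the induction over the lower central series.\<close>
lemma abelian_conjugate_products:
  assumes "carrier G \<subseteq> center G" "set xs \<subseteq> carrier G" "generate G (set xs) = carrier G"
  shows "conjugate_products G xs = carrier G"
proof
  show "carrier G \<subseteq> conjugate_products G xs"
  proof
    fix g assume "g \<in> carrier G"
    then have "g \<in> generate G (set xs)" using assms(3) by simp
    then show "g \<in> conjugate_products G xs"
    proof (induction rule: generate_left_induct[OF _ assms(2), consumes 1, case_names one mult inv_mult])
      case one
      then show ?case using one_in_conjugate_products[OF assms(2)] .
    next
      case (mult s h)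
      then show ?case
        using abelian_power_mult_conjugate_products[OF assms(1,2), of s h 1] assms(2) by auto
    next
      case (inv_mult s h)
      then show ?case
        using abelian_power_mult_conjugate_products[OF assms(1,2), of s h "-1"] assms(2)
        by (auto simp: int_pow_neg)
    qed
  qed
qed (rule conjugate_products_closed[OF assms(2)])

lemma lower_central_Suc_Suc:
  "lower_central G (Suc (Suc c)) =
   generate G {commutator G h g | h g. h \<in> lower_central G (Suc c) \<and> g \<in> carrier G}"
  by (simp add: commutator_def)

lemma commutator_in_lower_central:
  "\<lbrakk>h \<in> lower_central G (Suc c); g \<in> carrier G\<rbrakk> \<Longrightarrow> commutator G h g \<in> lower_central G (Suc (Suc c))"
  unfolding lower_central_Suc_Suc by (rule generate.incl) blast

lemma quotient_hom:
  assumes "N \<lhd> G"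
  shows "group_hom G (G Mod N) ((#>) N)" "(#>) N ` carrier G = carrier (G Mod N)"
    "\<lbrakk>x \<in> carrier G; y \<in> carrier G\<rbrakk> \<Longrightarrow> N #> x = N #> y \<longleftrightarrow> inv x \<otimes> y \<in> N"
    "\<lbrakk>x \<in> carrier G\<rbrakk> \<Longrightarrow> N #> x = \<one>\<^bsub>G Mod N\<^esub> \<longleftrightarrow> x \<in> N"
proof -
  interpret N: normal N G by fact
  show hom: "group_hom G (G Mod N) ((#>) N)"
    by (intro group_hom.intro group_hom_axioms.intro is_group N.factorgroup_is_group N.r_coset_hom_Mod)
  show "(#>) N ` carrier G = carrier (G Mod N)"
    by (auto simp: FactGroup_def RCOSETS_def)
  interpret \<pi>: group_hom G "G Mod N" "(#>) N" by (rule hom)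
  have one: "N #> x = \<one>\<^bsub>G Mod N\<^esub> \<longleftrightarrow> x \<in> N" if "x \<in> carrier G" for x
    using that coset_join1[of N x] coset_join2[of x N] N.is_subgroup by (auto simp: FactGroup_def)
  then show "\<lbrakk>x \<in> carrier G\<rbrakk> \<Longrightarrow> N #> x = \<one>\<^bsub>G Mod N\<^esub> \<longleftrightarrow> x \<in> N" .
  assume c: "x \<in> carrier G" "y \<in> carrier G"
  show "N #> x = N #> y \<longleftrightarrow> inv x \<otimes> y \<in> N"
    using c one[of "inv x \<otimes> y"] \<pi>.hom_eq_iff[OF c] by blast
qed

lemma lower_central_image_in_center:
  assumes z: "z \<in> lower_central G (Suc c)"
  shows "lower_central G (Suc (Suc c)) #> z \<in> center (G Mod lower_central G (Suc (Suc c)))"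
proof -
  define N where "N = lower_central G (Suc (Suc c))"
  define Q where "Q = G Mod N"
  define \<pi> where "\<pi> = (#>) N"
  have N: "N \<lhd> G" unfolding N_def by (rule lower_central_normal)
  interpret \<pi>: group_hom G Q \<pi> unfolding \<pi>_def Q_def using N by (rule quotient_hom)
  have surj: "\<pi> ` carrier G = carrier Q" unfolding \<pi>_def Q_def using N by (rule quotient_hom)
  have zc: "z \<in> carrier G"
    by (rule subgroup.mem_carrier[OF normal_imp_subgroup[OF lower_central_normal] z])
  have "\<pi> z \<otimes>\<^bsub>Q\<^esub> q = q \<otimes>\<^bsub>Q\<^esub> \<pi> z" if q: "q \<in> carrier Q" for q
  proof -
    obtain g where g: "g \<in> carrier G" "q = \<pi> g" using q surj by auto
    have "commutator G z g \<in> N"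
      using z g(1) by (simp only: N_def commutator_in_lower_central)
    then have "\<pi> (commutator G z g) = \<one>\<^bsub>Q\<^esub>"
      using quotient_hom(4)[OF N, of "commutator G z g"] zc g(1) by (simp add: \<pi>_def Q_def)
    then have "commutator Q (\<pi> z) (\<pi> g) = \<one>\<^bsub>Q\<^esub>"
      using zc g by (simp add: \<pi>.hom_commutator)
    then show ?thesis using \<pi>.H.mult_eq_commutator[of "\<pi> z" "\<pi> g"] zc g by simp
  qed
  then have "\<pi> z \<in> center Q" using \<pi>.hom_closed[OF zc] unfolding center_def by blast
  then show ?thesis by (simp add: \<pi>_def Q_def N_def)
qed

text \<open>By induction along the lower central series, starting with the abelian quotient \<open>G / \<gamma>\<^sub>2\<close>.  If \<open>g \<equiv> s\<close> modulo
  \<open>\<gamma>\<^sub>c\<close> with \<open>c \<ge> 2\<close>, the error \<open>s\<^sup>-\<^sup>1 g\<close> lies in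
  \<open>\<gamma>\<^sub>c = [\<gamma>\<^sub>c\<^sub>-\<^sub>1, G]\<close>, which is central modulo \<open>\<gamma>\<^sub>c\<^sub>+\<^sub>1\<close>; there the error is a product of one commutator
  \<open>[h, x]\<close> for each generator \<open>x\<close>, and \<open>s\<close> absorbs it.  The induction stays inside the fixed group \<open>G\<close> and only
  visits the quotients by \<open>\<gamma>\<^sub>c\<^sub>+\<^sub>1\<close>, because an induction over groups would have to change the element type.\<close>
lemma conjugate_products_mod_lower_central:
  assumes xs: "set xs \<subseteq> carrier G" "generate G (set xs) = carrier G" and "g \<in> carrier G"
  shows "\<exists>s\<in>conjugate_products G xs. inv s \<otimes> g \<in> lower_central G (Suc c)"
  using \<open>g \<in> carrier G\<close>
proof (induction c arbitrary: g)
  case 0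
  then show ?case using one_in_conjugate_products[OF xs(1)] by auto
next
  case (Suc c)
  define N where "N = lower_central G (Suc (Suc c))"
  define Q where "Q = G Mod N"
  define \<pi> where "\<pi> = (#>) N"
  have N: "N \<lhd> G" unfolding N_def by (rule lower_central_normal)
  interpret \<pi>: group_hom G Q \<pi> unfolding \<pi>_def Q_def using N by (rule quotient_hom)
  have surj: "\<pi> ` carrier G = carrier Q" unfolding \<pi>_def Q_def using N by (rule quotient_hom)
  have eq: "\<pi> x = \<pi> y \<longleftrightarrow> inv x \<otimes> y \<in> N" if "x \<in> carrier G" "y \<in> carrier G" for x y
    using quotient_hom(3)[OF N that] by (simp add: \<pi>_def)
  have gen: "set (map \<pi> xs) \<subseteq> carrier Q" "generate Q (set (map \<pi> xs)) = carrier Q"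
    using xs surj \<pi>.generate_img[OF xs(1)] by auto
  have central: "\<pi> z \<in> center Q" if "z \<in> lower_central G (Suc c)" for z
    using lower_central_image_in_center[OF that] by (simp add: \<pi>_def Q_def N_def)
  have "\<pi> g \<in> conjugate_products Q (map \<pi> xs)"
  proof (cases c)
    case 0
    then have "\<pi> ` carrier G \<subseteq> center Q" using central by auto
    then have "carrier Q \<subseteq> center Q" unfolding surj .
    then show ?thesis using \<pi>.H.abelian_conjugate_products[OF _ gen] Suc.prems by simp
  next
    case (Suc d)
    define H where "H = \<pi> ` lower_central G (Suc d)"
    have sub: "subgroup (lower_central G (Suc d)) G"
      by (rule normal_imp_subgroup[OF lower_central_normal])
    then have H: "subgroup H Q" unfolding H_def by (rule \<pi>.subgroup_img_is_subgroup)
    obtain s where s: "s \<in> conjugate_products G xs" "inv s \<otimes> g \<in> lower_central G (Suc c)"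
      using Suc.IH Suc.prems by blast
    have sc: "s \<in> carrier G" using s conjugate_products_closed[OF xs(1)] by auto
    let ?K = "{commutator G h g | h g. h \<in> lower_central G (Suc d) \<and> g \<in> carrier G}"
    have K: "?K \<subseteq> carrier G" using subgroup.mem_carrier[OF sub] by auto
    have imK: "\<pi> ` ?K \<subseteq> {commutator Q h q | h q. h \<in> H \<and> q \<in> carrier Q}"
      using subgroup.mem_carrier[OF sub] by (force simp: H_def \<pi>.hom_commutator)
    have "\<pi> (inv s \<otimes> g) \<in> \<pi> ` generate G ?K"
      using s(2) unfolding Suc lower_central_Suc_Suc by blast
    also have "\<dots> = generate Q (\<pi> ` ?K)" using \<pi>.generate_img[OF K] by simp
    also have "\<dots> \<subseteq> generate Q {commutator Q h q | h q. h \<in> H \<and> q \<in> carrier Q}"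
      by (rule \<pi>.H.mono_generate[OF imK])
    also have "\<dots> \<subseteq> commutator_products Q H (map \<pi> xs)"
    proof (rule \<pi>.H.generate_commutators_subset[OF H gen])
      fix h q assume "h \<in> H" "q \<in> carrier Q"
      then obtain h' g' where "h = \<pi> h'" "q = \<pi> g'" "h' \<in> lower_central G (Suc d)" "g' \<in> carrier G"
        unfolding H_def surj [symmetric] by blast
      then show "commutator Q h q \<in> center Q"
        using central[of "commutator G h' g'"] commutator_in_lower_central[of h' d g']
          subgroup.mem_carrier[OF sub] by (simp add: \<pi>.hom_commutator Suc)
    qed
    finally have z: "\<pi> (inv s \<otimes> g) \<in> commutator_products Q H (map \<pi> xs)" .
    have "\<pi> s \<otimes>\<^bsub>Q\<^esub> \<pi> (inv s \<otimes> g) \<in> conjugate_products Q (map \<pi> xs)"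
    proof (rule \<pi>.H.conjugate_products_absorb[OF _ gen(1) _ _ z])
      show "H \<subseteq> carrier Q" using H by (rule subgroup.subset)
      show "\<pi> s \<in> conjugate_products Q (map \<pi> xs)"
        using xs(1) s(1) by (rule \<pi>.conjugate_products_image)
      fix h q assume "h \<in> H" "q \<in> set (map \<pi> xs)"
      then obtain h' g' where "h = \<pi> h'" "q = \<pi> g'" "h' \<in> lower_central G (Suc d)" "g' \<in> carrier G"
        using xs(1) by (auto simp: H_def)
      then show "commutator Q h q \<in> center Q"
        using central[of "commutator G h' g'"] commutator_in_lower_central[of h' d g']
          subgroup.mem_carrier[OF sub] by (simp add: \<pi>.hom_commutator Suc)
    qed
    then show ?thesis using sc Suc.prems by (simp flip: \<pi>.hom_mult)
  qed
  then obtain s where s: "s \<in> conjugate_products G xs" "\<pi> s = \<pi> g"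
    using \<pi>.conjugate_products_lift[OF surj xs(1)] by blast
  then show ?case
    using eq[of s g] conjugate_products_closed[OF xs(1)] Suc.prems unfolding N_def by blast
qed

lemma conjugate_products_subset_palindrome_products:
  assumes S: "S \<subseteq> carrier G" "generate G S = carrier G" and "set xs \<subseteq> S"
  shows "conjugate_products G xs \<subseteq> palindrome_products G S (3 * length xs)"
  using assms(3)
proof (induction xs)
  case Nil
  then show ?case by (auto simp: palindrome_products_def)
next
  case (Cons x xs)
  have "x [^] k \<otimes> (g \<otimes> x \<otimes> inv g) \<otimes> s \<in> palindrome_products G S (1 + 2 + 3 * length xs)"
    if "g \<in> carrier G" "s \<in> conjugate_products G xs" for g s and k :: int
    using Cons that S
    by (intro palindrome_products_mult conjugate_generator_in_palindrome_products)
      (auto simp only: palindrome_products_1 power_in_palindromes list.set insert_subset subset_iff)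
  moreover have "1 + 2 + 3 * length xs = 3 * length (x # xs)" by simp
  ultimately have step: "x [^] k \<otimes> (g \<otimes> x \<otimes> inv g) \<otimes> s \<in> palindrome_products G S (3 * length (x # xs))"
    if "g \<in> carrier G" "s \<in> conjugate_products G xs" for g s and k :: int
    using that by metis
  show ?case
  proof
    fix q assume "q \<in> conjugate_products G (x # xs)"
    then obtain k :: int and g s where "q = x [^] k \<otimes> (g \<otimes> x \<otimes> inv g) \<otimes> s"
      "g \<in> carrier G" "s \<in> conjugate_products G xs" by auto
    then show "q \<in> palindrome_products G S (3 * length (x # xs))" using step by metis
  qed
qed

end

section \<open>Groups of class two\<close>

locale class2_group = group +
  assumes commutator_central: "\<lbrakk>x \<in> carrier G; y \<in> carrier G\<rbrakk> \<Longrightarrow> commutator G x y \<in> center G"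
begin

lemma commutator_int_pow_left:
  assumes "x \<in> carrier G" "y \<in> carrier G"
  shows "commutator G (x [^] (k :: int)) y = commutator G x y [^] k"
proof -
  have "(\<lambda>x. commutator G x y) \<in> hom G G"
    using assms commutator_central by (auto intro!: homI commutator_mult_left)
  from hom_int_pow[OF this assms(1) is_group is_group] show ?thesis .
qed

lemma commutator_int_pow_right:
  assumes "x \<in> carrier G" "y \<in> carrier G"
  shows "commutator G x (y [^] (k :: int)) = commutator G x y [^] k"
proof -
  have "(\<lambda>y. commutator G x y) \<in> hom G G"
    using assms commutator_central by (auto intro!: homI commutator_mult_right)
  from hom_int_pow[OF this assms(2) is_group is_group] show ?thesis .
qed

text \<open>The collection step for a letter \<open>y = x\<^sup>j\<close>, to be used with \<open>j = \<plusminus>1\<close>: from \<open>y h = h [h\<^sup>-\<^sup>1, y] y\<close> only the central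
  factor \<open>[h\<^sup>-\<^sup>1, y] = [a, x]\<close> is new, where \<open>a\<close> is \<open>h\<^sup>-\<^sup>1\<close> or \<open>h\<close>.\<close>
lemma mult_left_normal_form:
  assumes "x \<in> carrier G" "y \<in> carrier G" "h \<in> carrier G" "b \<in> carrier G"
    "commutator G (inv h) y = commutator G a x" "a \<in> carrier G"
    "y = x [^] (j :: int)"
  shows "y \<otimes> (h \<otimes> x [^] (k :: int) \<otimes> commutator G b x) = h \<otimes> x [^] (j + k) \<otimes> commutator G (a \<otimes> b) x"
proof -
  let ?c = "commutator G a x"
  have "y \<otimes> h = h \<otimes> ?c \<otimes> y"
    unfolding assms(5)[symmetric] using assms(1-3) by (simp add: commutator_def m_assoc)
  then have "y \<otimes> (h \<otimes> x [^] k \<otimes> commutator G b x) = h \<otimes> (?c \<otimes> (y \<otimes> (x [^] k \<otimes> commutator G b x)))"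
    using assms(1-4,6) by (simp add: m_assoc [symmetric])
  also have "?c \<otimes> (y \<otimes> (x [^] k \<otimes> commutator G b x)) = (y \<otimes> x [^] k) \<otimes> (?c \<otimes> commutator G b x)"
    using assms(1-4,6) commutator_central[of a x] center_left_commute[of ?c "y \<otimes> x [^] k" "commutator G b x"]
    by (simp add: m_assoc)
  finally show ?thesis
    using assms(1,3,4,6,7) commutator_central by (simp add: commutator_mult_left int_pow_mult m_assoc)
qed

text \<open>In class two a generator \<open>x\<close> can be collected behind all other ones: moving \<open>x\<close> to the right past \<open>h\<close> produces
  the central factor \<open>[h\<^sup>-\<^sup>1, x]\<close>, which multiplicativity merges into \<open>[b, x]\<close>.  Both \<open>h\<close> and \<open>b\<close>
  avoid \<open>x\<close>, so the same can be done next to another generator inside \<open>h\<close>.\<close>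
lemma generate_insert_normal_form:
  assumes "x \<in> carrier G" "Y \<subseteq> carrier G" "g \<in> generate G (insert x Y)"
  shows "\<exists>h\<in>generate G Y. \<exists>b\<in>generate G Y. \<exists>k::int. g = h \<otimes> x [^] k \<otimes> commutator G b x"
proof -
  have cl: "h \<in> carrier G" if "h \<in> generate G Y" for h
    using generate_in_carrier[OF assms(2) that] .
  note sub = generate_is_subgroup[OF assms(2)]
  have "insert x Y \<subseteq> carrier G" using assms by simp
  from assms(3) show ?thesis
  proof (induction rule: generate_left_induct[OF _ \<open>insert x Y \<subseteq> carrier G\<close>, consumes 1, case_names one mult inv_mult])
    case one
    have "\<one> = \<one> \<otimes> x [^] (0::int) \<otimes> commutator G \<one> x" using assms(1) by simp
    then show ?case using generate.one by blast
  next
    case (mult s g)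
    then obtain h b and k :: int where g: "h \<in> generate G Y" "b \<in> generate G Y"
      "g = h \<otimes> x [^] k \<otimes> commutator G b x" by blast
    show ?case
    proof (cases "s = x")
      case True
      have "s \<otimes> g = h \<otimes> x [^] (1 + k) \<otimes> commutator G (inv h \<otimes> b) x"
        unfolding g(3) using cl g assms(1) True by (intro mult_left_normal_form) auto
      moreover have "inv h \<otimes> b \<in> generate G Y"
        using g sub by (simp add: subgroup.m_closed subgroup.m_inv_closed)
      ultimately show ?thesis using g(1) by blast
    next
      case False
      then have "s \<in> generate G Y" using mult by (auto intro: generate.incl)
      then have "s \<otimes> h \<in> generate G Y" using g(1) by (rule generate.eng)
      moreover have "s \<otimes> g = (s \<otimes> h) \<otimes> x [^] k \<otimes> commutator G b x"
        using cl g assms(1,2) \<open>s \<noteq> x\<close> mult by (auto simp: m_assoc)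
      ultimately show ?thesis using g(2) by blast
    qed
  next
    case (inv_mult s g)
    then obtain h b and k :: int where g: "h \<in> generate G Y" "b \<in> generate G Y"
      "g = h \<otimes> x [^] k \<otimes> commutator G b x" by blast
    show ?case
    proof (cases "s = x")
      case True
      have "commutator G (inv h) (inv x) = commutator G h x"
      proof -
        have h: "h \<in> carrier G" using g(1) by (rule cl)
        have "commutator G (inv h) (inv x) = inv (commutator G h (inv x))"
          using h assms(1) commutator_central by (intro commutator_inv_left) auto
        also have "commutator G h (inv x) = inv (commutator G h x)"
          using h assms(1) commutator_central by (intro commutator_inv_right) auto
        finally show ?thesis using h assms(1) by simp
      qed
      then have "inv s \<otimes> g = h \<otimes> x [^] (-1 + k) \<otimes> commutator G (h \<otimes> b) x"
        unfolding g(3) using cl g assms(1) True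
        by (intro mult_left_normal_form) (auto simp: int_pow_neg)
      then show ?thesis using generate.eng[OF g(1,2)] g(1) by blast
    next
      case False
      then have "inv s \<in> generate G Y" using inv_mult by (auto intro: generate.inv)
      then have "inv s \<otimes> h \<in> generate G Y" using g(1) by (rule generate.eng)
      moreover have "inv s \<otimes> g = (inv s \<otimes> h) \<otimes> x [^] k \<otimes> commutator G b x"
        using cl g assms(1,2) \<open>s \<noteq> x\<close> inv_mult by (auto simp: m_assoc)
      ultimately show ?thesis using g(2) by blast
    qed
  qed
qed

lemma commutator_mult_eq_conjugate:
  "\<lbrakk>x \<in> carrier G; b \<in> carrier G\<rbrakk> \<Longrightarrow> x [^] (k :: int) \<otimes> commutator G b x = x [^] (k - 1) \<otimes> (b \<otimes> x \<otimes> inv b)"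
proof -
  assume c: "x \<in> carrier G" "b \<in> carrier G"
  have "x [^] k = x [^] (k - 1) \<otimes> x" using int_pow_mult[of x "k - 1" 1] c by simp
  then have "x [^] k \<otimes> commutator G b x = x [^] (k - 1) \<otimes> (x \<otimes> commutator G b x)"
    using c by (simp add: m_assoc)
  also have "x \<otimes> commutator G b x = commutator G b x \<otimes> x"
    by (rule center_commute [symmetric]) (use c commutator_central in simp_all)
  also have "\<dots> = b \<otimes> x \<otimes> inv b" using c by (simp add: commutator_def m_assoc)
  finally show ?thesis .
qed

text \<open>The collected form of the elements of a two-generated group of class two.  It multiplies like an integral
  upper unitriangular \<open>3 \<times> 3\<close> matrix, so that identities between words become identities between integer triples.\<close>
definition heisenberg_form :: "'a \<Rightarrow> 'a \<Rightarrow> int \<Rightarrow> int \<Rightarrow> int \<Rightarrow> 'a" where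
  "heisenberg_form y x a b c = y [^] a \<otimes> x [^] b \<otimes> commutator G y x [^] c"

lemma int_pow_in_center: "z \<in> center G \<Longrightarrow> z [^] (k :: int) \<in> center G"
proof -
  assume z: "z \<in> center G"
  have "commutator G (z [^] k) g = \<one>" if "g \<in> carrier G" for g
    using z that commutator_int_pow_left[of z g k] center_commute[OF z that]
    by (simp add: commutator_def m_assoc)
  then show ?thesis using z mult_eq_commutator[of "z [^] k"] unfolding center_def by auto
qed

lemma heisenberg_form_mult:
  assumes "x \<in> carrier G" "y \<in> carrier G"
  shows "heisenberg_form y x a b c \<otimes> heisenberg_form y x a' b' c' = heisenberg_form y x (a + a') (b + b') (c + c' - b * a')"
proof -
  let ?z = "commutator G y x"
  have z: "?z [^] (i::int) \<in> center G" for i :: int using assms commutator_central int_pow_in_center by simp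
  have "commutator G (x [^] b) (y [^] a') = ?z [^] (- (b * a'))"
  proof -
    have "commutator G (x [^] b) (y [^] a') = (commutator G x y [^] a') [^] b"
      using assms by (simp add: commutator_int_pow_left commutator_int_pow_right int_pow_pow mult.commute)
    also have "commutator G x y = ?z [^] (-1 :: int)"
      using assms by (simp add: int_pow_neg inv_commutator)
    finally show ?thesis using assms by (simp add: int_pow_pow mult.commute)
  qed
  then have swap: "x [^] b \<otimes> y [^] a' = ?z [^] (- (b * a')) \<otimes> (y [^] a' \<otimes> x [^] b)"
    using assms mult_eq_commutator[of "x [^] b" "y [^] a'"] by simp
  have "heisenberg_form y x a b c \<otimes> heisenberg_form y x a' b' c' =
      y [^] a \<otimes> (x [^] b \<otimes> (?z [^] c \<otimes> (y [^] a' \<otimes> x [^] b' \<otimes> ?z [^] c')))"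
    using assms by (simp add: heisenberg_form_def m_assoc)
  also have "?z [^] c \<otimes> (y [^] a' \<otimes> x [^] b' \<otimes> ?z [^] c') = y [^] a' \<otimes> x [^] b' \<otimes> (?z [^] c \<otimes> ?z [^] c')"
    using z assms by (intro center_left_commute [symmetric]) simp_all
  also have "y [^] a \<otimes> (x [^] b \<otimes> (y [^] a' \<otimes> x [^] b' \<otimes> (?z [^] c \<otimes> ?z [^] c'))) =
      y [^] a \<otimes> ((x [^] b \<otimes> y [^] a') \<otimes> (x [^] b' \<otimes> (?z [^] c \<otimes> ?z [^] c')))"
    using assms by (simp add: m_assoc)
  also have "\<dots> = y [^] a \<otimes> (?z [^] (- (b * a')) \<otimes> (y [^] a' \<otimes> x [^] b \<otimes> (x [^] b' \<otimes> (?z [^] c \<otimes> ?z [^] c'))))"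
    unfolding swap using assms by (simp add: m_assoc)
  also have "?z [^] (- (b * a')) \<otimes> (y [^] a' \<otimes> x [^] b \<otimes> (x [^] b' \<otimes> (?z [^] c \<otimes> ?z [^] c'))) =
      ?z [^] (- (b * a')) \<otimes> ((y [^] a' \<otimes> x [^] b \<otimes> x [^] b') \<otimes> (?z [^] c \<otimes> ?z [^] c'))"
    using assms by (simp add: m_assoc)
  also have "\<dots> = (y [^] a' \<otimes> x [^] b \<otimes> x [^] b') \<otimes> (?z [^] (- (b * a')) \<otimes> (?z [^] c \<otimes> ?z [^] c'))"
    using z assms by (intro center_left_commute [symmetric]) simp_all
  also have "y [^] a \<otimes> \<dots> = (y [^] a \<otimes> y [^] a') \<otimes> (x [^] b \<otimes> x [^] b') \<otimes> (?z [^] (- (b * a')) \<otimes> (?z [^] c \<otimes> ?z [^] c'))"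
    using assms by (simp add: m_assoc)
  also have "\<dots> = heisenberg_form y x (a + a') (b + b') (- (b * a') + (c + c'))"
    using assms by (simp only: heisenberg_form_def int_pow_mult commutator_closed)
  finally show ?thesis by (simp add: algebra_simps)
qed

lemma heisenberg_form_power_left: "\<lbrakk>x \<in> carrier G; y \<in> carrier G\<rbrakk> \<Longrightarrow> y [^] a = heisenberg_form y x a 0 0"
  and heisenberg_form_power_right: "\<lbrakk>x \<in> carrier G; y \<in> carrier G\<rbrakk> \<Longrightarrow> x [^] b = heisenberg_form y x 0 b 0"
  by (simp_all add: heisenberg_form_def)

text \<open>Write \<open>g = y\<^sup>a x\<^sup>k [y, x]\<^sup>d\<close> and split off a conjugate of one generator, which costs two palindromes;
  the exponents of what remains must be those of one palindrome.  If \<open>a = 2 j\<close>, split off a conjugate of \<open>x\<close> and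
  use \<open>y\<^sup>j x\<^sup>k\<^sup>-\<^sup>1 y\<^sup>j\<close>; if \<open>a = 2 j + 1\<close>, split off a conjugate of \<open>y\<close> and use \<open>y\<^sup>j x\<^sup>k y\<^sup>j\<close>.  The conjugating power
  corrects the exponent of \<open>[y, x]\<close>.\<close>
lemma two_generator_palindrome_products:
  assumes S: "S \<subseteq> carrier G" "x \<in> S" "y \<in> S" and g: "g \<in> generate G {x, y}"
  shows "g \<in> palindrome_products G S 3"
proof -
  have c: "x \<in> carrier G" "y \<in> carrier G" using S by auto
  obtain h b and k :: int where h: "h \<in> generate G {y}" "b \<in> generate G {y}"
    "g = h \<otimes> x [^] k \<otimes> commutator G b x"
    using generate_insert_normal_form[of x "{y}" g] c g by auto
  then obtain a d :: int where ad: "h = y [^] a" "b = y [^] d" using generate_pow[OF c(2)] by auto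
  have g: "g = heisenberg_form y x a k d" using c by (simp add: h(3) ad heisenberg_form_def commutator_int_pow_left)
  note simps = heisenberg_form_power_left[OF c] heisenberg_form_power_right[OF c] heisenberg_form_mult[OF c]
  have gen: "s [^] (m :: int) \<in> generate G S" if "s \<in> S" for s m
    using subgroup_int_pow_closed[OF generate_is_subgroup[OF S(1)]] generate.incl[OF that] by blast
  have prod: "p \<otimes> (t [^] m \<otimes> s [^] (1::int) \<otimes> t [^] (- m)) \<in> palindrome_products G S 3"
    if "p \<in> palindromes G S" "s \<in> S" "t \<in> S" for p s t and m :: int
    using palindrome_products_mult[OF S(1), of p 1, OF _ conjugate_generator_in_palindrome_products[OF S(1) that(2) gen[OF that(3)]]]
      that palindrome_products_1[OF S(1)] S(1) by (simp add: numeral_3_eq_3 int_pow_neg subset_iff)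
  show ?thesis
  proof (cases "even a")
    case True
    then obtain j where j: "a = 2 * j" by blast
    \<comment> \<open>The palindrome contributes \<open>- (k - 1) * j\<close> to the exponent of \<open>[y, x]\<close>.\<close>
    let ?m = "d + (k - 1) * j"
    have "y [^] j \<otimes> x [^] (k - 1) \<otimes> y [^] j \<otimes> (y [^] ?m \<otimes> x [^] (1::int) \<otimes> y [^] (- ?m)) = g"
      unfolding simps g j by (simp add: algebra_simps)
    moreover have "y [^] j \<otimes> x [^] (k - 1) \<otimes> y [^] j \<in> palindromes G S"
      using S by (intro palindrome_between_powers power_in_palindromes)
    ultimately show ?thesis using prod[OF _ S(2,3), of _ ?m] by metis
  next
    case False
    then obtain j where j: "a = 2 * j + 1" by (blast elim: oddE)
    \<comment> \<open>The palindrome contributes \<open>- k * j\<close>, moving \<open>y\<close> past \<open>x\<^sup>k\<close> contributes \<open>- k\<close>, and conjugation of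
      \<open>y\<close> by \<open>x\<^sup>m\<close> contributes \<open>- m\<close>.\<close>
    let ?m = "- (d + k * j + k)"
    have "y [^] j \<otimes> x [^] k \<otimes> y [^] j \<otimes> (x [^] ?m \<otimes> y [^] (1::int) \<otimes> x [^] (- ?m)) = g"
      unfolding simps g j by (simp add: algebra_simps)
    moreover have "y [^] j \<otimes> x [^] k \<otimes> y [^] j \<in> palindromes G S"
      using S by (intro palindrome_between_powers power_in_palindromes)
    ultimately show ?thesis using prod[OF _ S(3,2), of _ ?m] by metis
  qed
qed

text \<open>Collecting the generators one after the other, each new \<open>x\<close> contributes \<open>x\<^sup>k [b, x] = x\<^sup>k\<^sup>-\<^sup>1 (b x b\<^sup>-\<^sup>1)\<close>, that
  is three palindromes, and the last two generators together need only three.\<close>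
lemma generate_subset_palindrome_products:
  assumes S: "S \<subseteq> carrier G" and "set xs \<subseteq> S" "length xs \<ge> 2" "g \<in> generate G (set xs)"
  shows "g \<in> palindrome_products G S (3 * (length xs - 1))"
  using assms(2-)
proof (induction xs arbitrary: g rule: induct_list012)
  case (3 x y zs)
  show ?case
  proof (cases "zs = []")
    case True
    then show ?thesis using two_generator_palindrome_products[OF S, of x y g] 3 by simp
  next
    case False
    let ?xs = "y # zs"
    have c: "x \<in> carrier G" "set ?xs \<subseteq> carrier G" "x \<in> S" using 3 S by auto
    obtain h b and k :: int where h: "h \<in> generate G (set ?xs)" "b \<in> generate G (set ?xs)"
      "g = h \<otimes> x [^] k \<otimes> commutator G b x"
      using generate_insert_normal_form[OF c(1,2), of g] 3(5) by (simp only: list.set) blast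
    have hb: "h \<in> carrier G" "b \<in> carrier G" using h generate_in_carrier[OF c(2)] by auto
    have "b \<in> generate G S" using h(2) mono_generate[of "set ?xs" S] 3 by auto
    then have "x [^] (k - 1) \<otimes> (b \<otimes> x \<otimes> inv b) \<in> palindrome_products G S (1 + 2)"
      using c S palindrome_products_1[OF S]
      by (intro palindrome_products_mult conjugate_generator_in_palindrome_products)
        (auto intro: power_in_palindromes)
    moreover have "h \<in> palindrome_products G S (3 * (length ?xs - 1))"
      using 3 h False by (cases zs) auto
    ultimately have "h \<otimes> (x [^] (k - 1) \<otimes> (b \<otimes> x \<otimes> inv b)) \<in> palindrome_products G S (3 * (length ?xs - 1) + (1 + 2))"
      using palindrome_products_mult[OF S] by blast
    moreover have "h \<otimes> (x [^] (k - 1) \<otimes> (b \<otimes> x \<otimes> inv b)) = g"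
    proof -
      have "x [^] (k - 1) \<otimes> (b \<otimes> x \<otimes> inv b) = x [^] k \<otimes> commutator G b x"
        by (rule commutator_mult_eq_conjugate [symmetric]) (use c hb in simp_all)
      then show ?thesis using c hb by (simp add: h(3) m_assoc)
    qed
    ultimately show ?thesis by (simp add: eval_nat_numeral)
  qed
qed simp_all

end

section \<open>The Heisenberg group modulo two\<close>

text \<open>The dihedral group of order eight, with the triple \<open>(a, b, c)\<close> standing for the unitriangular matrix over the field
  with two elements that has \<open>b\<close> and \<open>a\<close> next to the diagonal and \<open>c\<close> in the corner.  It serves the lower bound since it has class
  two and is generated by two involutions that do not commute.\<close>
definition heis_mod2 :: "(bool \<times> bool \<times> bool) monoid" where
  "heis_mod2 = \<lparr>carrier = UNIV,
     monoid.mult = (\<lambda>(a, b, c) (a', b', c'). (a \<noteq> a', b \<noteq> b', (c \<noteq> c') \<noteq> (b \<and> a'))),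
     one = (False, False, False)\<rparr>"

lemma heis_mod2_simps [simp]:
  "carrier heis_mod2 = UNIV" "\<one>\<^bsub>heis_mod2\<^esub> = (False, False, False)"
  "(a, b, c) \<otimes>\<^bsub>heis_mod2\<^esub> (a', b', c') = (a \<noteq> a', b \<noteq> b', (c \<noteq> c') \<noteq> (b \<and> a'))"
  by (simp_all add: heis_mod2_def)

interpretation D: group heis_mod2
proof (rule groupI)
  fix x :: "bool \<times> bool \<times> bool"
  obtain a b c where x: "x = (a, b, c)" by (cases x)
  show "\<exists>y\<in>carrier heis_mod2. y \<otimes>\<^bsub>heis_mod2\<^esub> x = \<one>\<^bsub>heis_mod2\<^esub>"
    unfolding x by (intro bexI[of _ "(a, b, c \<noteq> (a \<and> b))"]) auto
qed (auto split: prod.splits)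

lemma heis_mod2_inv [simp]: "inv\<^bsub>heis_mod2\<^esub> (a, b, c) = (a, b, c \<noteq> (a \<and> b))"
  by (rule D.inv_equality) auto

lemma lower_central_heis_mod2: "lower_central heis_mod2 (k + 3) = {\<one>\<^bsub>heis_mod2\<^esub>}"
proof (induction k)
  case 0
  let ?Z = "{(False, False, c) | c. True}"
  have sub: "subgroup ?Z heis_mod2"
    by (rule D.subgroupI) auto
  have "commutator heis_mod2 x y \<in> ?Z" for x y
    by (cases x; cases y) (auto simp: commutator_def)
  then have "lower_central heis_mod2 2 \<subseteq> ?Z"
    unfolding numeral_2_eq_2 lower_central.simps
    by (intro D.generate_subgroup_incl[OF _ sub]) (auto simp: commutator_def)
  then have *: "{commutator heis_mod2 x y | x y. x \<in> lower_central heis_mod2 2 \<and> y \<in> carrier heis_mod2} \<subseteq> {\<one>\<^bsub>heis_mod2\<^esub>}"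
    by (force simp: commutator_def)
  have "generate heis_mod2 {commutator heis_mod2 x y | x y. x \<in> lower_central heis_mod2 2 \<and> y \<in> carrier heis_mod2} \<subseteq> {\<one>\<^bsub>heis_mod2\<^esub>}"
    by (rule D.generate_subgroup_incl[OF * D.triv_subgroup])
  then show ?case
    using generate.one[of heis_mod2]
    by (auto simp: numeral_3_eq_3 numeral_2_eq_2 commutator_def)
next
  case (Suc k)
  have *: "{commutator heis_mod2 x y | x y. x \<in> lower_central heis_mod2 (k + 3) \<and> y \<in> carrier heis_mod2} \<subseteq> {\<one>\<^bsub>heis_mod2\<^esub>}"
    unfolding Suc by (force simp: commutator_def)
  have "generate heis_mod2 {commutator heis_mod2 x y | x y. x \<in> lower_central heis_mod2 (k + 3) \<and> y \<in> carrier heis_mod2} \<subseteq> {\<one>\<^bsub>heis_mod2\<^esub>}"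
    by (rule D.generate_subgroup_incl[OF * D.triv_subgroup])
  then show ?case
    using generate.one[of heis_mod2]
    by (auto simp: numeral_3_eq_3 commutator_def)
qed

lemma (in group_hom) hom_lower_central:
  "h ` lower_central G k \<subseteq> lower_central H k"
proof (induction k rule: induct_nat_012)
  case (ge2 k)
  let ?K = "{commutator G x y | x y. x \<in> lower_central G (Suc k) \<and> y \<in> carrier G}"
  have c: "x \<in> carrier G" if "x \<in> lower_central G (Suc k)" for x
    using that subgroup.mem_carrier[OF normal_imp_subgroup[OF G.lower_central_normal]] by blast
  then have K: "?K \<subseteq> carrier G" by auto
  have "h ` lower_central G (Suc (Suc k)) = generate H (h ` ?K)"
    using generate_img[OF K] by (simp add: commutator_def)
  also have "\<dots> \<subseteq> lower_central H (Suc (Suc k))"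
  proof -
    have "h ` ?K \<subseteq> {commutator H x y | x y. x \<in> lower_central H (Suc k) \<and> y \<in> carrier H}"
      using ge2(2) c by (force simp: hom_commutator)
    then show ?thesis using H.mono_generate by (simp add: commutator_def)
  qed
  finally show ?case .
qed auto

lemma heis_mod2_fst: "fst (x \<otimes>\<^bsub>heis_mod2\<^esub> y) = (fst x \<noteq> fst y)"
  and heis_mod2_snd: "fst (snd (x \<otimes>\<^bsub>heis_mod2\<^esub> y)) = (fst (snd x) \<noteq> fst (snd y))"
  by (cases x; cases y; simp)+

lemma fst_list_mult_heis_mod2:
  "fst (list_mult heis_mod2 xs) = odd (length (filter fst xs))"
  "fst (snd (list_mult heis_mod2 xs)) = odd (length (filter (fst \<circ> snd) xs))"
  by (induction xs) (auto simp: heis_mod2_fst heis_mod2_snd)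

lemma heis_mod2_conjugate:
  "fst (u \<otimes>\<^bsub>heis_mod2\<^esub> t \<otimes>\<^bsub>heis_mod2\<^esub> inv\<^bsub>heis_mod2\<^esub> u) = fst t"
  by (cases u; cases t) auto

section \<open>Middle letters of palindromes\<close>

lemma (in group_hom) hom_list_mult:
  "set xs \<subseteq> carrier G \<Longrightarrow> h (list_mult G xs) = list_mult H (map h xs)"
  by (induction xs) (auto simp: G.list_mult_closed)

text \<open>Under a homomorphism \<open>\<psi>\<close> that sends each generator to an involution or to \<open>\<one>\<close>, reversing a word inverts its
  value.  Hence a palindrome \<open>w w'\<close> with \<open>w'\<close> the reversal of \<open>w\<close> becomes trivial, and \<open>w t w'\<close> becomes a conjugate of the image of its
  middle letter \<open>t\<close>.  One choice of the middle letter serves all such \<open>\<psi>\<close> at once.\<close>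
lemma (in group) palindrome_middle_letter:
  fixes D :: "('d, 'e) monoid_scheme"
  assumes "S \<subseteq> carrier G" "p \<in> palindromes G S" "group D"
  shows "\<exists>m. set_option m \<subseteq> S \<and> (\<forall>\<psi>\<in>hom G D. (\<forall>s\<in>S. \<psi> s \<otimes>\<^bsub>D\<^esub> \<psi> s = \<one>\<^bsub>D\<^esub>) \<longrightarrow>
           (case m of None \<Rightarrow> \<psi> p = \<one>\<^bsub>D\<^esub>
            | Some t \<Rightarrow> \<exists>u\<in>carrier D. \<psi> p = u \<otimes>\<^bsub>D\<^esub> \<psi> t \<otimes>\<^bsub>D\<^esub> inv\<^bsub>D\<^esub> u))"
proof -
  interpret D: group D by fact
  obtain w where w: "p = word_value G w" "set w \<subseteq> S \<times> UNIV" "rev w = w"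
    using assms(2) by (auto simp: palindromes_def palindromic_word_def)
  have letter: "\<psi> (letter_value G a) = \<psi> (fst a)" "inv\<^bsub>D\<^esub> \<psi> (fst a) = \<psi> (fst a)"
    if "\<psi> \<in> hom G D" "\<forall>s\<in>S. \<psi> s \<otimes>\<^bsub>D\<^esub> \<psi> s = \<one>\<^bsub>D\<^esub>" "fst a \<in> S" for \<psi> :: "'a \<Rightarrow> 'd" and a
  proof -
    interpret \<psi>: group_hom G D \<psi>
      by (intro group_hom.intro group_hom_axioms.intro is_group assms that)
    have c: "fst a \<in> carrier G" using that assms(1) by auto
    show i: "inv\<^bsub>D\<^esub> \<psi> (fst a) = \<psi> (fst a)"
      using that c by (intro D.inv_equality) auto
    show "\<psi> (letter_value G a) = \<psi> (fst a)" using i c by (cases a) auto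
  qed
  show ?thesis using w(2,3) unfolding w(1)
  proof (induction "length w" arbitrary: w rule: less_induct)
    case less
    from less.prems(2) show ?case
    proof (cases rule: palindrome_cases)
      case 1
      then show ?thesis
        using hom_one[OF _ is_group \<open>group D\<close>] by (intro exI[of _ None]) auto
    next
      case (2 a)
      then have a: "fst a \<in> S" using less.prems by auto
      then have c: "fst a \<in> carrier G" using assms(1) by auto
      have "word_value G w = letter_value G a"
        using 2 c by (simp add: word_value_Cons letter_value_closed)
      then have "\<exists>u\<in>carrier D. \<psi> (word_value G w) = u \<otimes>\<^bsub>D\<^esub> \<psi> (fst a) \<otimes>\<^bsub>D\<^esub> inv\<^bsub>D\<^esub> u"
        if "\<psi> \<in> hom G D" "\<forall>s\<in>S. \<psi> s \<otimes>\<^bsub>D\<^esub> \<psi> s = \<one>\<^bsub>D\<^esub>" for \<psi>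
        using letter(1)[OF that a] hom_in_carrier[OF that(1) c] by (intro bexI[of _ "\<one>\<^bsub>D\<^esub>"]) auto
      then show ?thesis using a by (intro exI[of _ "Some (fst a)"]) auto
    next
      case (3 a v)
      then have a: "fst a \<in> S" and vS: "set v \<subseteq> S \<times> UNIV" using less.prems by auto
      then have c: "fst a \<in> carrier G" and v: "fst ` set v \<subseteq> carrier G" using assms(1) by auto
      obtain m where m: "set_option m \<subseteq> S" "\<forall>\<psi>\<in>hom G D. (\<forall>s\<in>S. \<psi> s \<otimes>\<^bsub>D\<^esub> \<psi> s = \<one>\<^bsub>D\<^esub>) \<longrightarrow>
           (case m of None \<Rightarrow> \<psi> (word_value G v) = \<one>\<^bsub>D\<^esub>
            | Some t \<Rightarrow> \<exists>u\<in>carrier D. \<psi> (word_value G v) = u \<otimes>\<^bsub>D\<^esub> \<psi> t \<otimes>\<^bsub>D\<^esub> inv\<^bsub>D\<^esub> u)"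
        using less.hyps[of v] 3 vS by auto
      have "case m of None \<Rightarrow> \<psi> (word_value G w) = \<one>\<^bsub>D\<^esub>
            | Some t \<Rightarrow> \<exists>u\<in>carrier D. \<psi> (word_value G w) = u \<otimes>\<^bsub>D\<^esub> \<psi> t \<otimes>\<^bsub>D\<^esub> inv\<^bsub>D\<^esub> u"
        if \<psi>: "\<psi> \<in> hom G D" "\<forall>s\<in>S. \<psi> s \<otimes>\<^bsub>D\<^esub> \<psi> s = \<one>\<^bsub>D\<^esub>" for \<psi>
      proof -
        have mv: "case m of None \<Rightarrow> \<psi> (word_value G v) = \<one>\<^bsub>D\<^esub>
            | Some t \<Rightarrow> \<exists>u\<in>carrier D. \<psi> (word_value G v) = u \<otimes>\<^bsub>D\<^esub> \<psi> t \<otimes>\<^bsub>D\<^esub> inv\<^bsub>D\<^esub> u"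
          using m(2) \<psi> by blast
        interpret \<psi>: group_hom G D \<psi>
          by (intro group_hom.intro group_hom_axioms.intro is_group assms that)
        let ?a = "\<psi> (fst a)"
        have ac: "?a \<in> carrier D" using c by simp
        have "word_value G w = letter_value G a \<otimes> word_value G v \<otimes> letter_value G a"
          using 3 c v by (simp add: word_value_Cons word_value_append letter_value_closed word_value_closed m_assoc)
        then have eq: "\<psi> (word_value G w) = ?a \<otimes>\<^bsub>D\<^esub> \<psi> (word_value G v) \<otimes>\<^bsub>D\<^esub> inv\<^bsub>D\<^esub> ?a"
          using letter[OF \<psi> a] c v by (simp add: letter_value_closed word_value_closed)
        show ?thesis
        proof (cases m)
          case None
          then show ?thesis using mv eq ac by simp
        next
          case (Some t)
          then obtain u where u: "u \<in> carrier D"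
            "\<psi> (word_value G v) = u \<otimes>\<^bsub>D\<^esub> \<psi> t \<otimes>\<^bsub>D\<^esub> inv\<^bsub>D\<^esub> u" using mv by auto
          have "\<psi> t \<in> carrier D" using Some m(1) assms(1) by auto
          then have "\<psi> (word_value G w) = (?a \<otimes>\<^bsub>D\<^esub> u) \<otimes>\<^bsub>D\<^esub> \<psi> t \<otimes>\<^bsub>D\<^esub> inv\<^bsub>D\<^esub> (?a \<otimes>\<^bsub>D\<^esub> u)"
            using eq u ac by (simp add: D.inv_mult_group D.m_assoc)
          then show ?thesis using Some u(1) ac by auto
        qed
      qed
      then show ?thesis using m(1) by blast
    qed
  qed
qed

lemma sum_count_options_le:
  assumes "finite A"
  shows "(\<Sum>i\<in>A. length (filter (\<lambda>p. f p = Some i) ps)) \<le> length ps"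
proof (induction ps)
  case (Cons p ps)
  have "(\<Sum>i\<in>A. length (filter (\<lambda>p. f p = Some i) (p # ps))) =
        (\<Sum>i\<in>A. of_bool (f p = Some i)) + (\<Sum>i\<in>A. length (filter (\<lambda>p. f p = Some i) ps))"
    by (simp flip: sum.distrib) (rule sum.cong, auto)
  also have "(\<Sum>i\<in>A. of_bool (f p = Some i)) \<le> (1 :: nat)"
  proof (cases "f p")
    case (Some j)
    then show ?thesis using assms by (simp add: of_bool_def)
  qed simp
  finally show ?case using Cons by simp
qed simp

text \<open>Let \<open>P = x\<^sub>1 \<cdots> x\<^sub>n\<close> and write \<open>P\<^sup>2\<close> as a product of palindromes.  The homomorphism that sends \<open>x\<^sub>i\<close> to an involution
  and all other generators to \<open>\<one>\<close> kills \<open>P\<^sup>2\<close>, so \<open>x\<^sub>i\<close> is the middle letter of an even number of the palindromes.  If neither \<open>x\<^sub>i\<close> nor \<open>x\<^sub>j\<close> occurred as a middle letter,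
  then all the palindromes, hence also \<open>P\<^sup>2\<close>, would be killed by the homomorphism that sends \<open>x\<^sub>i\<close> and \<open>x\<^sub>j\<close> to
  non-commuting involutions \<open>s\<close> and \<open>t\<close> and all other generators to \<open>\<one>\<close>; but it maps \<open>P\<^sup>2\<close> to \<open>(s t)\<^sup>2\<close> or \<open>(t s)\<^sup>2\<close>, and these differ from \<open>\<one>\<close>.  So at
  least \<open>n - 1\<close> generators occur as middle letters, each at least twice.\<close>
lemma (in group) palindromic_width_ge:
  fixes b :: "nat \<Rightarrow> 'a"
  assumes b: "b ` {1..n} \<subseteq> carrier G"
    and homs: "\<And>f. \<exists>\<psi>\<in>hom G heis_mod2. \<forall>i\<in>{1..n}. \<psi> (b i) = f i"
  shows "enat (2 * (n - 1)) \<le> palindromic_width G (b ` {1..n})"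
proof -
  let ?S = "b ` {1..n}"
  define P where "P = list_mult G (map b [1..<Suc n])"
  have set: "set (map b [1..<Suc n]) = ?S" by auto
  have P: "P \<in> carrier G" unfolding P_def by (rule list_mult_closed) (use b set in simp)
  have "2 * (n - 1) \<le> length ps" if ps: "set ps \<subseteq> palindromes G ?S" "list_mult G ps = P \<otimes> P" for ps
  proof -
    have psc: "set ps \<subseteq> carrier G" using ps(1) palindromes_closed[OF b] by auto
    define good where "good \<psi> \<longleftrightarrow> \<psi> \<in> hom G heis_mod2 \<and>
      (\<forall>s\<in>?S. \<psi> s \<otimes>\<^bsub>heis_mod2\<^esub> \<psi> s = \<one>\<^bsub>heis_mod2\<^esub>)" for \<psi>
    define middle where "middle p m \<longleftrightarrow> (\<forall>\<psi>. good \<psi> \<longrightarrow> (case m of None \<Rightarrow> \<psi> p = \<one>\<^bsub>heis_mod2\<^esub>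
        | Some i \<Rightarrow> i \<in> {1..n} \<and>
            (\<exists>u. \<psi> p = u \<otimes>\<^bsub>heis_mod2\<^esub> \<psi> (b i) \<otimes>\<^bsub>heis_mod2\<^esub> inv\<^bsub>heis_mod2\<^esub> u)))" for p m
    have "\<exists>m. middle p m" if p: "p \<in> palindromes G ?S" for p
    proof -
      obtain m where m: "set_option m \<subseteq> ?S" "\<And>\<psi>. good \<psi> \<Longrightarrow> (case m of None \<Rightarrow> \<psi> p = \<one>\<^bsub>heis_mod2\<^esub>
        | Some t \<Rightarrow> \<exists>u\<in>carrier heis_mod2. \<psi> p = u \<otimes>\<^bsub>heis_mod2\<^esub> \<psi> t \<otimes>\<^bsub>heis_mod2\<^esub> inv\<^bsub>heis_mod2\<^esub> u)"
        using palindrome_middle_letter[OF b p D.is_group] unfolding good_def by blast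
      show ?thesis
      proof (cases m)
        case None
        then show ?thesis using m(2) unfolding middle_def by (intro exI[of _ None]) simp
      next
        case (Some t)
        then obtain i where "i \<in> {1..n}" "t = b i" using m(1) by auto
        then show ?thesis using m(2) Some unfolding middle_def by (intro exI[of _ "Some i"]) fastforce
      qed
    qed
    then obtain M where M: "\<And>p. p \<in> palindromes G ?S \<Longrightarrow> middle p (M p)" by metis
    have mid: "M p = None \<Longrightarrow> \<psi> p = \<one>\<^bsub>heis_mod2\<^esub>"
      "M p = Some k \<Longrightarrow> k \<in> {1..n} \<and> (\<exists>u. \<psi> p = u \<otimes>\<^bsub>heis_mod2\<^esub> \<psi> (b k) \<otimes>\<^bsub>heis_mod2\<^esub> inv\<^bsub>heis_mod2\<^esub> u)"
      if "p \<in> set ps" "good \<psi>" for p \<psi> k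
      using M[of p] that ps(1) unfolding middle_def by (force split: option.splits)+
    define c where "c i = length (filter (\<lambda>p. M p = Some i) ps)" for i
    have hom_eq: "list_mult heis_mod2 (map \<psi> ps) = \<psi> P \<otimes>\<^bsub>heis_mod2\<^esub> \<psi> P" if "good \<psi>" for \<psi>
    proof -
      interpret \<psi>: group_hom G heis_mod2 \<psi>
        using that by (intro group_hom.intro group_hom_axioms.intro is_group D.is_group) (simp add: good_def)
      show ?thesis using \<psi>.hom_list_mult[OF psc] ps(2) P by simp
    qed
    have even: "even (c i)" if i: "i \<in> {1..n}" for i
    proof -
      obtain \<psi> where \<psi>: "\<psi> \<in> hom G heis_mod2" "\<forall>j\<in>{1..n}. \<psi> (b j) = (j = i, False, False)"
        using homs[of "\<lambda>j. (j = i, False, False)"] by blast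
      have good: "good \<psi>" using \<psi> by (auto simp: good_def)
      \<comment> \<open>Modulo two, the first coordinate counts the palindromes with middle letter \<open>b i\<close>.\<close>
      have "fst (\<psi> p) = (M p = Some i)" if "p \<in> set ps" for p
      proof (cases "M p")
        case None
        then show ?thesis using mid(1)[OF that good] by simp
      next
        case (Some k)
        from mid(2)[OF that good this] obtain u where k: "k \<in> {1..n}"
          "\<psi> p = u \<otimes>\<^bsub>heis_mod2\<^esub> \<psi> (b k) \<otimes>\<^bsub>heis_mod2\<^esub> inv\<^bsub>heis_mod2\<^esub> u" by blast
        have "fst (\<psi> p) = fst (\<psi> (b k))" unfolding k(2) by (rule heis_mod2_conjugate)
        then show ?thesis using Some k(1) \<psi>(2) by auto
      qed
      then have "filter (fst \<circ> \<psi>) ps = filter (\<lambda>p. M p = Some i) ps"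
        by (intro filter_cong) auto
      then have "odd (c i) = fst (list_mult heis_mod2 (map \<psi> ps))"
        by (simp add: fst_list_mult_heis_mod2 filter_map c_def)
      also have "\<dots> = False" unfolding hom_eq[OF good] heis_mod2_fst by simp
      finally show ?thesis by simp
    qed
    have nonzero: "c i \<noteq> 0 \<or> c j \<noteq> 0" if ij: "i \<in> {1..n}" "j \<in> {1..n}" "i \<noteq> j" for i j
    proof (rule ccontr)
      assume "\<not> ?thesis"
      then have M_ne: "M p \<noteq> Some i" "M p \<noteq> Some j" if "p \<in> set ps" for p
        using that by (auto simp: c_def filter_empty_conv)
      obtain \<psi> where \<psi>: "\<psi> \<in> hom G heis_mod2" "\<forall>k\<in>{1..n}. \<psi> (b k) = (k = i, k = j, False)"
        using homs[of "\<lambda>k. (k = i, k = j, False)"] by blast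
      have good: "good \<psi>" using \<psi> ij(3) by (auto simp: good_def)
      have "\<psi> p = \<one>\<^bsub>heis_mod2\<^esub>" if "p \<in> set ps" for p
      proof (cases "M p")
        case None
        then show ?thesis using mid(1)[OF that good] by simp
      next
        case (Some k)
        from mid(2)[OF that good this] obtain u where k: "k \<in> {1..n}"
          "\<psi> p = u \<otimes>\<^bsub>heis_mod2\<^esub> \<psi> (b k) \<otimes>\<^bsub>heis_mod2\<^esub> inv\<^bsub>heis_mod2\<^esub> u" by blast
        moreover have "\<psi> (b k) = \<one>\<^bsub>heis_mod2\<^esub>" using Some M_ne[OF that] k(1) \<psi>(2) by auto
        ultimately show ?thesis by (cases u) auto
      qed
      then have "list_mult heis_mod2 (map \<psi> ps) = \<one>\<^bsub>heis_mod2\<^esub>"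
        by (induction ps) auto
      then have square: "\<psi> P \<otimes>\<^bsub>heis_mod2\<^esub> \<psi> P = \<one>\<^bsub>heis_mod2\<^esub>" using hom_eq[OF good] by simp
      interpret \<psi>: group_hom G heis_mod2 \<psi>
        by (intro group_hom.intro group_hom_axioms.intro is_group D.is_group \<psi>)
      have img: "\<psi> P = list_mult heis_mod2 (map (\<lambda>k. (k = i, k = j, False)) [1..<Suc n])"
      proof -
        have "map (\<psi> \<circ> b) [1..<Suc n] = map (\<lambda>k. (k = i, k = j, False)) [1..<Suc n]"
          using \<psi>(2) by (intro map_cong) (auto simp del: upt_Suc)
        then show ?thesis
          unfolding P_def using \<psi>.hom_list_mult[of "map b [1..<Suc n]"] b set by (simp only: map_map)
      qed
      have one: "length (filter (\<lambda>k. k = l) [1..<Suc n]) = 1" if "l \<in> {1..n}" for l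
      proof -
        have "{k. k = l} \<inter> set [1..<Suc n] = {l}" using that by auto
        then show ?thesis using distinct_length_filter[of "[1..<Suc n]" "\<lambda>k. k = l"] by simp
      qed
      have "fst (\<psi> P)" "fst (snd (\<psi> P))"
        unfolding img fst_list_mult_heis_mod2 filter_map using one[OF ij(1)] one[OF ij(2)]
        by (simp_all add: o_def)
      then show False using square by (cases "\<psi> P") auto
    qed
    obtain i0 where i0: "\<And>i. i \<in> {1..n} - {i0} \<Longrightarrow> c i \<noteq> 0"
      using nonzero by (metis Diff_iff insertI1)
    have "2 * (n - 1) \<le> (\<Sum>i\<in>{1..n} - {i0}. 2)"
      by (cases "i0 \<in> {1..n}") (auto simp: card_Diff_subset)
    also have "\<dots> \<le> (\<Sum>i\<in>{1..n} - {i0}. c i)"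
      by (rule sum_mono) (use i0 even in \<open>force elim: evenE\<close>)
    also have "\<dots> \<le> (\<Sum>i\<in>{1..n}. c i)" by (rule sum_mono2) auto
    also have "\<dots> \<le> length ps" unfolding c_def by (rule sum_count_options_le) simp
    finally show ?thesis .
  qed
  then have "enat (2 * (n - 1)) \<le> palindromic_length G ?S (P \<otimes> P)"
    unfolding palindromic_length_def by (auto simp: le_Inf_iff)
  also have "\<dots> \<le> palindromic_width G ?S"
    unfolding palindromic_width_def using P by (intro SUP_upper) simp
  finally show ?thesis .
qed

section \<open>Free nilpotent groups\<close>

lemma free_nilpotent_basis_closed: "free_nilpotent_basis n r \<subseteq> carrier (free_nilpotent n r)"
  unfolding generate_free_nilpotent [symmetric] by (auto intro: generate.incl)

text \<open>A map from the basis extends to the free group, and the extension kills \<open>\<gamma>\<^sub>r\<^sub>+\<^sub>1\<close> because the target has class two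
  and \<open>r \<ge> 2\<close>.\<close>
lemma free_nilpotent_hom_heis_mod2:
  assumes "r \<ge> 2"
  shows "\<exists>\<psi>\<in>hom (free_nilpotent n r) heis_mod2. \<forall>i\<in>{1..n}.
    \<psi> (lower_central (free_group {1..n}) (r + 1) #>\<^bsub>free_group {1..n}\<^esub> [(i, True)]) = f i"
proof -
  let ?F = "free_group {1..n}" and ?\<phi> = "\<lambda>w. word_value heis_mod2 (map (apfst f) w)"
  interpret \<phi>: group_hom ?F heis_mod2 ?\<phi>
    by (intro group_hom.intro group_hom_axioms.intro group_free_group D.is_group free_group_hom) simp
  have "?\<phi> ` lower_central ?F (r + 1) \<subseteq> {\<one>\<^bsub>heis_mod2\<^esub>}"
    using \<phi>.hom_lower_central[of "r + 1"] lower_central_heis_mod2[of "r - 2"] assms by simp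
  moreover have sub: "lower_central ?F (r + 1) \<subseteq> carrier ?F"
    using \<phi>.G.lower_central_normal normal_imp_subgroup subgroup.subset by blast
  ultimately have "lower_central ?F (r + 1) \<subseteq> kernel ?F heis_mod2 ?\<phi>"
    by (auto simp: kernel_def)
  then obtain \<psi> where \<psi>: "\<psi> \<in> hom (free_nilpotent n r) heis_mod2"
    "\<And>w. w \<in> carrier ?F \<Longrightarrow> \<psi> (lower_central ?F (r + 1) #>\<^bsub>?F\<^esub> w) = ?\<phi> w"
    using \<phi>.FactGroup_universal_kernel[OF \<phi>.G.lower_central_normal] unfolding free_nilpotent_def by metis
  have "[(i, True)] \<in> carrier ?F" if "i \<in> {1..n}" for i
    using that by (simp add: free_group_def freely_reduced_Cons)
  then show ?thesis using \<psi> D.word_value_Cons by (intro bexI[of _ \<psi>]) (auto simp del: One_nat_def)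
qed

lemma free_nilpotent_lower_bound:
  assumes "r \<ge> 2"
  shows "enat (2 * (n - 1)) \<le> palindromic_width (free_nilpotent n r) (free_nilpotent_basis n r)"
proof -
  interpret N: group "free_nilpotent n r" by (rule group_free_nilpotent)
  show ?thesis
    using free_nilpotent_basis_closed[of n r] unfolding free_nilpotent_basis_def
    by (rule N.palindromic_width_ge) (rule free_nilpotent_hom_heis_mod2[OF assms])
qed

lemma free_nilpotent_upper_bound:
  "palindromic_width (free_nilpotent n r) (free_nilpotent_basis n r) \<le> enat (3 * n)"
proof (rule palindromic_width_le)
  let ?F = "free_group {1..n}" and ?N = "free_nilpotent n r" and ?B = "free_nilpotent_basis n r"
  let ?K = "lower_central ?F (Suc r)"
  interpret F: group ?F by (rule group_free_group)
  interpret \<pi>: group_hom ?F ?N "(#>\<^bsub>?F\<^esub>) ?K"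
    unfolding free_nilpotent_def using F.quotient_hom(1)[OF F.lower_central_normal[of "Suc r"]] by simp
  have surj: "(#>\<^bsub>?F\<^esub>) ?K ` carrier ?F = carrier ?N"
    unfolding free_nilpotent_def using F.quotient_hom(2)[OF F.lower_central_normal[of "Suc r"]] by simp
  let ?xs = "map (\<lambda>i. [(i, True)]) [1..<Suc n]"
  have set_xs: "set ?xs = (\<lambda>i. [(i, True)]) ` {1..n}" by auto
  have gen: "generate ?F (set ?xs) = carrier ?F" unfolding set_xs by (rule generate_free_group)
  have xs: "set ?xs \<subseteq> carrier ?F" unfolding gen [symmetric] by (auto intro: generate.incl)
  have B: "set (map ((#>\<^bsub>?F\<^esub>) ?K) ?xs) = ?B"
    unfolding free_nilpotent_basis_def by (auto simp: image_image)
  have genB: "?B \<subseteq> carrier ?N" "generate ?N ?B = carrier ?N"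
    by (rule free_nilpotent_basis_closed generate_free_nilpotent)+
  fix q assume "q \<in> carrier ?N"
  then obtain g where g: "g \<in> carrier ?F" "q = ?K #>\<^bsub>?F\<^esub> g" using surj by auto
  obtain s where s: "s \<in> conjugate_products ?F ?xs" "inv\<^bsub>?F\<^esub> s \<otimes>\<^bsub>?F\<^esub> g \<in> ?K"
    using F.conjugate_products_mod_lower_central[OF xs gen g(1)] by blast
  have "s \<in> carrier ?F" using s(1) F.conjugate_products_closed[OF xs] by auto
  then have "q = ?K #>\<^bsub>?F\<^esub> s"
    using F.quotient_hom(3)[OF F.lower_central_normal] s(2) g by metis
  then have q: "q \<in> conjugate_products ?N (map ((#>\<^bsub>?F\<^esub>) ?K) ?xs)"
    using \<pi>.conjugate_products_image[OF xs s(1)] by simp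
  have sub: "conjugate_products ?N (map ((#>\<^bsub>?F\<^esub>) ?K) ?xs)
      \<subseteq> palindrome_products ?N ?B (3 * length (map ((#>\<^bsub>?F\<^esub>) ?K) ?xs))"
    using \<pi>.H.conjugate_products_subset_palindrome_products[OF genB equalityD1[OF B]] .
  have len: "length (map ((#>\<^bsub>?F\<^esub>) ?K) ?xs) = n" by (simp del: upt_Suc)
  show "q \<in> palindrome_products ?N ?B (3 * n)"
    by (rule subsetD[OF sub[unfolded len] q])
qed

text \<open>Commutators lie in \<open>\<gamma>\<^sub>2\<close>, whose image is central modulo \<open>\<gamma>\<^sub>3\<close>.\<close>
lemma free_nilpotent_2_class2: "class2_group (free_nilpotent n 2)"
proof -
  let ?F = "free_group {1..n}"
  let ?K = "lower_central ?F (Suc (Suc 1))"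
  interpret F: group ?F by (rule group_free_group)
  have N: "free_nilpotent n 2 = ?F Mod ?K" by (simp add: free_nilpotent_def numeral_2_eq_2)
  interpret \<pi>: group_hom ?F "free_nilpotent n 2" "(#>\<^bsub>?F\<^esub>) ?K"
    unfolding N by (rule F.quotient_hom(1)[OF F.lower_central_normal[of "Suc (Suc 1)"]])
  have surj: "(#>\<^bsub>?F\<^esub>) ?K ` carrier ?F = carrier (free_nilpotent n 2)"
    unfolding N by (rule F.quotient_hom(2)[OF F.lower_central_normal[of "Suc (Suc 1)"]])
  show ?thesis
  proof (intro class2_group.intro class2_group_axioms.intro \<pi>.H.is_group)
    fix x y assume "x \<in> carrier (free_nilpotent n 2)" "y \<in> carrier (free_nilpotent n 2)"
    then obtain g h where gh: "g \<in> carrier ?F" "h \<in> carrier ?F" "x = ?K #>\<^bsub>?F\<^esub> g" "y = ?K #>\<^bsub>?F\<^esub> h"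
      unfolding surj [symmetric] by blast
    have "commutator ?F g h \<in> lower_central ?F (Suc 1)"
      using F.commutator_in_lower_central[of g 0 h] gh by simp
    then show "commutator (free_nilpotent n 2) x y \<in> center (free_nilpotent n 2)"
      using F.lower_central_image_in_center[of "commutator ?F g h" 1] gh(1,2)
      unfolding gh(3,4) N [symmetric] by (simp only: \<pi>.hom_commutator)
  qed
qed

lemma free_nilpotent_2_upper_bound:
  assumes "n \<ge> 2"
  shows "palindromic_width (free_nilpotent n 2) (free_nilpotent_basis n 2) \<le> enat (3 * (n - 1))"
proof (rule palindromic_width_le)
  let ?N = "free_nilpotent n 2" and ?B = "free_nilpotent_basis n 2"
  interpret N: class2_group ?N by (rule free_nilpotent_2_class2)
  note B = free_nilpotent_basis_closed[of n 2]
  obtain xs where xs: "set xs = ?B" "length xs = n"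
    unfolding free_nilpotent_basis_def
    by (metis (no_types, lifting) atLeastLessThanSuc_atLeastAtMost diff_Suc_1 length_map length_upt list.set_map set_upt)
  fix q assume "q \<in> carrier ?N"
  then show "q \<in> palindrome_products ?N ?B (3 * (n - 1))"
    using N.generate_subset_palindrome_products[OF B, of xs q] xs assms generate_free_nilpotent[of n 2] by simp
qed

theorem corollary1:
  fixes n :: nat
  assumes "n \<ge> 2"
  shows "(\<forall>r\<ge>3. enat (2 * (n - 1)) \<le> palindromic_width (free_nilpotent n r) (free_nilpotent_basis n r)
              \<and> palindromic_width (free_nilpotent n r) (free_nilpotent_basis n r) \<le> enat (3 * n))
       \<and> (enat (2 * (n - 1)) \<le> palindromic_width (free_nilpotent n 2) (free_nilpotent_basis n 2)
              \<and> palindromic_width (free_nilpotent n 2) (free_nilpotent_basis n 2) \<le> enat (3 * (n - 1)))"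
  using assms
  by (intro conjI allI impI free_nilpotent_lower_bound free_nilpotent_upper_bound
      free_nilpotent_2_upper_bound) simp_all

end
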